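(* Let $\mathcal B$ be a 2-category and let $F\colon(\Delta_{\le2})^{op}\to\mathcal B$ be a pseudofunctor, with values $B_0,B_1,B_2$, 1-morphisms $s_i,d_j$ and invertible 2-morphisms $\alpha_i,\beta_j$ as in the context. An extension of $F$ to a pseudofunctor $\widehat F\colon((\Delta_{\le2})^{op})^{\rhd}\to\mathcal B$ is specified by - an object $B_f$ of $\mathcal B$, - a 1-morphism $t_0\colon B_0\to B_f$, and - an invertible 2-morphism $\theta\colon t_0d_0\Rightarrow t_0d_1$ (where $d_0,d_1\colon B_1\to B_0$), such that the following equalities hold, where $*$ denotes whiskering of 2-cells by 1-cells and $\circ$ denotes vertical composition of 2-cells: - $\theta*s_0=t_0*\big((\beta_0)^{-1}\circ\beta_1\big)\colon t_0d_0s_0\to t_0d_1s_0$; - $(t_0*(\alpha_1)^{-1})\circ(\theta*d_0)=(\theta^{-1}*d_2)\circ(t_0*\alpha_2)\circ(\theta*d_1)\circ(t_0*\alpha_0)\colon t_0d_0d_0\to t_0d_0d_2$.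
   Context: $\Delta_{\le2}$ is the full subcategory of the simplex category $\Delta$ on $[0],[1],[2]$, regarded as a 2-category with only identity 2-morphisms. $((\Delta_{\le2})^{op})^{\rhd}$ is the category obtained from $(\Delta_{\le2})^{op}$ by adjoining a new terminal object $f$; an extension of $F$ is a pseudofunctor $\widehat F$ whose restriction along the inclusion $(\Delta_{\le2})^{op}\hookrightarrow((\Delta_{\le2})^{op})^{\rhd}$ is $F$. Pseudofunctors preserve composition and identities up to specified coherent invertible 2-cells, and are considered up to equivalence; "specified by" means determined up to equivalence by. Data of $F$: $B_n=F([n])$; the 1-morphisms $s_0\colon B_0\to B_1$, $d_0,d_1\colon B_1\to B_0$, $s_0,s_1\colon B_1\to B_2$, $d_0,d_1,d_2\colon B_2\to B_1$ are the images of the standard degeneracies and faces. The invertible 2-morphisms used in the statement, given by the coherence of $F$ and the simplicial identities, are $\alpha_0\colon d_0d_0\Rightarrow d_0d_1$, $\alpha_1\colon d_0d_2\Rightarrow d_1d_0$, $\alpha_2\colon d_1d_1\Rightarrow d_1d_2$ in $\mathcal B(B_2,B_0)$, and $\beta_0\colon d_1s_0\Rightarrow\mathrm{id}$, $\beta_1\colon d_0s_0\Rightarrow\mathrm{id}$ in $\mathcal B(B_0,B_0)$. Juxtaposition $d_id_j$ means $d_i\circ d_j$. *)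

theory Defs
  imports "HOL-Library.FuncSet"
begin

section \<open>Categories and strict 2-categories\<close>

text \<open>
  Categories and 2-categories are records with explicit carriers; all operations are only
  meaningful on the carriers and on composable arguments.
  Composition is written in the usual order: \<open>g \<cdot> f\<close> is \<open>f\<close> followed by \<open>g\<close>.
\<close>

record ('o, 'm) cat =
  obs :: "'o set"
  arrs :: "'m set"
  src :: "'m \<Rightarrow> 'o"
  tgt :: "'m \<Rightarrow> 'o"
  cmp :: "'m \<Rightarrow> 'm \<Rightarrow> 'm"  (infixl "\<cdot>\<index>" 75)
  idn :: "'o \<Rightarrow> 'm"

definition Hom :: "('o, 'm, 'x) cat_scheme \<Rightarrow> 'o \<Rightarrow> 'o \<Rightarrow> 'm set" where
  "Hom C a b = {f \<in> arrs C. src C f = a \<and> tgt C f = b}"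

locale category =
  fixes C :: "('o, 'm, 'x) cat_scheme" (structure)
  assumes src_ob: "f \<in> arrs C \<Longrightarrow> src C f \<in> obs C"
    and tgt_ob: "f \<in> arrs C \<Longrightarrow> tgt C f \<in> obs C"
    and id_hom: "a \<in> obs C \<Longrightarrow> idn C a \<in> Hom C a a"
    and cmp_hom: "f \<in> Hom C a b \<Longrightarrow> g \<in> Hom C b c \<Longrightarrow> g \<cdot> f \<in> Hom C a c"
    and id_left: "f \<in> Hom C a b \<Longrightarrow> idn C b \<cdot> f = f"
    and id_right: "f \<in> Hom C a b \<Longrightarrow> f \<cdot> idn C a = f"
    and assoc: "f \<in> Hom C a b \<Longrightarrow> g \<in> Hom C b c \<Longrightarrow> h \<in> Hom C c d
      \<Longrightarrow> (h \<cdot> g) \<cdot> f = h \<cdot> (g \<cdot> f)"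

record ('o, 'm, 'c) twocat = "('o, 'm) cat" +
  cells :: "'c set"
  src2 :: "'c \<Rightarrow> 'm"
  tgt2 :: "'c \<Rightarrow> 'm"
  vcmp :: "'c \<Rightarrow> 'c \<Rightarrow> 'c"  (infixl "\<bullet>\<index>" 65)
  hcmp :: "'c \<Rightarrow> 'c \<Rightarrow> 'c"  (infixl "\<star>\<index>" 70)
  idn2 :: "'m \<Rightarrow> 'c"

definition Hom2 :: "('o, 'm, 'c) twocat \<Rightarrow> 'm \<Rightarrow> 'm \<Rightarrow> 'c set" where
  "Hom2 B f g = {\<alpha> \<in> cells B. src2 B \<alpha> = f \<and> tgt2 B \<alpha> = g}"

definition vertical :: "('o, 'm, 'c) twocat \<Rightarrow> ('m, 'c) cat" where
  "vertical B = \<lparr>obs = arrs B, arrs = cells B, src = src2 B, tgt = tgt2 B,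
     cmp = vcmp B, idn = idn2 B\<rparr>"

definition horizontal :: "('o, 'm, 'c) twocat \<Rightarrow> ('o, 'c) cat" where
  "horizontal B = \<lparr>obs = obs B, arrs = cells B,
     src = (\<lambda>\<alpha>. src B (src2 B \<alpha>)), tgt = (\<lambda>\<alpha>. tgt B (src2 B \<alpha>)),
     cmp = hcmp B, idn = (\<lambda>a. idn2 B (idn B a))\<rparr>"

locale two_category = category B for B :: "('o, 'm, 'c) twocat" (structure) +
  assumes globular_src: "\<alpha> \<in> cells B \<Longrightarrow> src B (tgt2 B \<alpha>) = src B (src2 B \<alpha>)"
    and globular_tgt: "\<alpha> \<in> cells B \<Longrightarrow> tgt B (tgt2 B \<alpha>) = tgt B (src2 B \<alpha>)"
    and vertical_category: "category (vertical B)"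
    and horizontal_category: "category (horizontal B)"
    and hcmp_hom2: "\<lbrakk>f \<in> Hom B a b; g \<in> Hom B b c; \<alpha> \<in> Hom2 B f f'; \<beta> \<in> Hom2 B g g'\<rbrakk>
      \<Longrightarrow> \<beta> \<star> \<alpha> \<in> Hom2 B (g \<cdot> f) (g' \<cdot> f')"
    and hcmp_idn2: "\<lbrakk>f \<in> Hom B a b; g \<in> Hom B b c\<rbrakk> \<Longrightarrow> idn2 B g \<star> idn2 B f = idn2 B (g \<cdot> f)"
    and interchange: "\<lbrakk>f \<in> Hom B a b; g \<in> Hom B b c; \<alpha> \<in> Hom2 B f f'; \<alpha>' \<in> Hom2 B f' f'';
        \<beta> \<in> Hom2 B g g'; \<beta>' \<in> Hom2 B g' g''\<rbrakk>
      \<Longrightarrow> (\<beta>' \<bullet> \<beta>) \<star> (\<alpha>' \<bullet> \<alpha>) = (\<beta>' \<star> \<alpha>') \<bullet> (\<beta> \<star> \<alpha>)"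

text \<open>Whiskering of a 2-cell by a 1-cell on the left and on the right.\<close>

definition lwhisker :: "('o, 'm, 'c) twocat \<Rightarrow> 'm \<Rightarrow> 'c \<Rightarrow> 'c"  (infixl "\<rhd>\<index>" 70) where
  "g \<rhd>\<^bsub>B\<^esub> \<alpha> = idn2 B g \<star>\<^bsub>B\<^esub> \<alpha>"

definition rwhisker :: "('o, 'm, 'c) twocat \<Rightarrow> 'c \<Rightarrow> 'm \<Rightarrow> 'c"  (infixl "\<lhd>\<index>" 70) where
  "\<alpha> \<lhd>\<^bsub>B\<^esub> f = \<alpha> \<star>\<^bsub>B\<^esub> idn2 B f"

definition inverse2 :: "('o, 'm, 'c) twocat \<Rightarrow> 'c \<Rightarrow> 'c \<Rightarrow> bool" where
  "inverse2 B \<alpha> \<beta> \<longleftrightarrow> \<beta> \<in> Hom2 B (tgt2 B \<alpha>) (src2 B \<alpha>) \<and>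
     \<beta> \<bullet>\<^bsub>B\<^esub> \<alpha> = idn2 B (src2 B \<alpha>) \<and> \<alpha> \<bullet>\<^bsub>B\<^esub> \<beta> = idn2 B (tgt2 B \<alpha>)"

definition inv2 :: "('o, 'm, 'c) twocat \<Rightarrow> 'c \<Rightarrow> 'c" where
  "inv2 B \<alpha> = (THE \<beta>. inverse2 B \<alpha> \<beta>)"

definition Iso2 :: "('o, 'm, 'c) twocat \<Rightarrow> 'm \<Rightarrow> 'm \<Rightarrow> 'c set" where
  "Iso2 B f g = {\<alpha> \<in> Hom2 B f g. \<exists>\<beta>. inverse2 B \<alpha> \<beta>}"

section \<open>Pseudofunctors, pseudonatural transformations, modifications\<close>

text \<open>
  \<open>on_cmp F g f : F g \<cdot> F f \<Rightarrow> F (g \<cdot> f)\<close> and \<open>on_id F a : id \<Rightarrow> F id\<close> are the coherence 2-cells.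
\<close>

record ('o, 'm, 'c, 'p, 'n, 'd) pfun =
  on_ob :: "'o \<Rightarrow> 'p"
  on_arr :: "'m \<Rightarrow> 'n"
  on_cell :: "'c \<Rightarrow> 'd"
  on_cmp :: "'m \<Rightarrow> 'm \<Rightarrow> 'd"
  on_id :: "'o \<Rightarrow> 'd"

locale pseudofunctor = A: two_category A + B: two_category B
  for A :: "('o, 'm, 'c) twocat" and B :: "('p, 'n, 'd) twocat" (structure) +
  fixes F :: "('o, 'm, 'c, 'p, 'n, 'd) pfun"
  assumes ob: "a \<in> obs A \<Longrightarrow> on_ob F a \<in> obs B"
    and arr: "f \<in> Hom A a b \<Longrightarrow> on_arr F f \<in> Hom B (on_ob F a) (on_ob F b)"
    and cell: "\<alpha> \<in> Hom2 A f g \<Longrightarrow> on_cell F \<alpha> \<in> Hom2 B (on_arr F f) (on_arr F g)"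
    and cell_idn2: "f \<in> arrs A \<Longrightarrow> on_cell F (idn2 A f) = idn2 B (on_arr F f)"
    and cell_vcmp: "\<lbrakk>\<alpha> \<in> Hom2 A f g; \<beta> \<in> Hom2 A g h\<rbrakk>
      \<Longrightarrow> on_cell F (\<beta> \<bullet>\<^bsub>A\<^esub> \<alpha>) = on_cell F \<beta> \<bullet> on_cell F \<alpha>"
    and cmp_iso: "\<lbrakk>f \<in> Hom A a b; g \<in> Hom A b c\<rbrakk>
      \<Longrightarrow> on_cmp F g f \<in> Iso2 B (on_arr F g \<cdot> on_arr F f) (on_arr F (g \<cdot>\<^bsub>A\<^esub> f))"
    and id_iso: "a \<in> obs A
      \<Longrightarrow> on_id F a \<in> Iso2 B (idn B (on_ob F a)) (on_arr F (idn A a))"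
    and cmp_natural: "\<lbrakk>f \<in> Hom A a b; g \<in> Hom A b c; \<alpha> \<in> Hom2 A f f'; \<beta> \<in> Hom2 A g g'\<rbrakk>
      \<Longrightarrow> on_cmp F g' f' \<bullet> (on_cell F \<beta> \<star> on_cell F \<alpha>)
          = on_cell F (\<beta> \<star>\<^bsub>A\<^esub> \<alpha>) \<bullet> on_cmp F g f"
    and cmp_assoc: "\<lbrakk>f \<in> Hom A a b; g \<in> Hom A b c; h \<in> Hom A c d\<rbrakk>
      \<Longrightarrow> on_cmp F (h \<cdot>\<^bsub>A\<^esub> g) f \<bullet> (on_cmp F h g \<lhd> on_arr F f)
          = on_cmp F h (g \<cdot>\<^bsub>A\<^esub> f) \<bullet> (on_arr F h \<rhd> on_cmp F g f)"
    and unit_right: "f \<in> Hom A a b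
      \<Longrightarrow> on_cmp F f (idn A a) \<bullet> (on_arr F f \<rhd> on_id F a) = idn2 B (on_arr F f)"
    and unit_left: "f \<in> Hom A a b
      \<Longrightarrow> on_cmp F (idn A b) f \<bullet> (on_id F b \<lhd> on_arr F f) = idn2 B (on_arr F f)"

text \<open>Equality of pseudofunctors out of \<open>A\<close>: the record components agree on the carriers.\<close>

definition pfun_eq ::
  "('o, 'm, 'c) twocat \<Rightarrow> ('o, 'm, 'c, 'p, 'n, 'd) pfun \<Rightarrow> ('o, 'm, 'c, 'p, 'n, 'd) pfun \<Rightarrow> bool"
  where
  "pfun_eq A F G \<longleftrightarrow>
     (\<forall>a\<in>obs A. on_ob F a = on_ob G a) \<and>
     (\<forall>f\<in>arrs A. on_arr F f = on_arr G f) \<and>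
     (\<forall>\<alpha>\<in>cells A. on_cell F \<alpha> = on_cell G \<alpha>) \<and>
     (\<forall>f\<in>arrs A. \<forall>g\<in>arrs A. src A g = tgt A f \<longrightarrow> on_cmp F g f = on_cmp G g f) \<and>
     (\<forall>a\<in>obs A. on_id F a = on_id G a)"

record ('o, 'm, 'n, 'd) ptrans =
  at_ob :: "'o \<Rightarrow> 'n"
  at_arr :: "'m \<Rightarrow> 'd"

locale pseudonatural = G: pseudofunctor A B G + H: pseudofunctor A B H
  for A :: "('o, 'm, 'c) twocat" and B :: "('p, 'n, 'd) twocat" (structure)
    and G H :: "('o, 'm, 'c, 'p, 'n, 'd) pfun" +
  fixes \<sigma> :: "('o, 'm, 'n, 'd) ptrans"
  assumes at_ob_hom: "a \<in> obs A \<Longrightarrow> at_ob \<sigma> a \<in> Hom B (on_ob G a) (on_ob H a)"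
    and at_arr_iso: "f \<in> Hom A a b
      \<Longrightarrow> at_arr \<sigma> f \<in> Iso2 B (on_arr H f \<cdot> at_ob \<sigma> a) (at_ob \<sigma> b \<cdot> on_arr G f)"
    and at_arr_natural: "\<lbrakk>f \<in> Hom A a b; \<phi> \<in> Hom2 A f g\<rbrakk>
      \<Longrightarrow> at_arr \<sigma> g \<bullet> (on_cell H \<phi> \<lhd> at_ob \<sigma> a)
          = (at_ob \<sigma> b \<rhd> on_cell G \<phi>) \<bullet> at_arr \<sigma> f"
    and at_arr_id: "a \<in> obs A
      \<Longrightarrow> at_arr \<sigma> (idn A a) \<bullet> (on_id H a \<lhd> at_ob \<sigma> a) = at_ob \<sigma> a \<rhd> on_id G a"
    and at_arr_cmp: "\<lbrakk>f \<in> Hom A a b; g \<in> Hom A b c\<rbrakk>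
      \<Longrightarrow> at_arr \<sigma> (g \<cdot>\<^bsub>A\<^esub> f) \<bullet> (on_cmp H g f \<lhd> at_ob \<sigma> a)
          = (at_ob \<sigma> c \<rhd> on_cmp G g f) \<bullet> (at_arr \<sigma> g \<lhd> on_arr G f) \<bullet> (on_arr H g \<rhd> at_arr \<sigma> f)"

definition ptrans_id ::
  "('p, 'n, 'd) twocat \<Rightarrow> ('o, 'm, 'c, 'p, 'n, 'd) pfun \<Rightarrow> ('o, 'm, 'n, 'd) ptrans" where
  "ptrans_id B F =
     \<lparr>at_ob = (\<lambda>a. idn B (on_ob F a)), at_arr = (\<lambda>f. idn2 B (on_arr F f))\<rparr>"

definition ptrans_cmp ::
  "('o, 'm, 'c) twocat \<Rightarrow> ('p, 'n, 'd) twocat \<Rightarrow> ('o, 'm, 'n, 'd) ptrans \<Rightarrow>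
   ('o, 'm, 'n, 'd) ptrans \<Rightarrow> ('o, 'm, 'n, 'd) ptrans" where
  "ptrans_cmp A B \<tau> \<sigma> =
     \<lparr>at_ob = (\<lambda>a. at_ob \<tau> a \<cdot>\<^bsub>B\<^esub> at_ob \<sigma> a),
      at_arr = (\<lambda>f. (at_ob \<tau> (tgt A f) \<rhd>\<^bsub>B\<^esub> at_arr \<sigma> f) \<bullet>\<^bsub>B\<^esub>
                     (at_arr \<tau> f \<lhd>\<^bsub>B\<^esub> at_ob \<sigma> (src A f)))\<rparr>"

locale modification = S: pseudonatural A B G H \<sigma> + T: pseudonatural A B G H \<tau>
  for A :: "('o, 'm, 'c) twocat" and B :: "('p, 'n, 'd) twocat" (structure)
    and G H :: "('o, 'm, 'c, 'p, 'n, 'd) pfun" and \<sigma> \<tau> :: "('o, 'm, 'n, 'd) ptrans" +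
  fixes \<Gamma> :: "'o \<Rightarrow> 'd"
  assumes at_ob_hom2: "a \<in> obs A \<Longrightarrow> \<Gamma> a \<in> Hom2 B (at_ob \<sigma> a) (at_ob \<tau> a)"
    and modif: "f \<in> Hom A a b
      \<Longrightarrow> at_arr \<tau> f \<bullet> (on_arr H f \<rhd> \<Gamma> a) = (\<Gamma> b \<lhd> on_arr G f) \<bullet> at_arr \<sigma> f"

definition invertible_modification where
  "invertible_modification A B G H \<sigma> \<tau> \<Gamma> \<longleftrightarrow>
     modification A B G H \<sigma> \<tau> \<Gamma> \<and> (\<forall>a\<in>obs A. \<Gamma> a \<in> Iso2 B (at_ob \<sigma> a) (at_ob \<tau> a))"

section \<open>Constructions on categories\<close>

definition opcat :: "('o, 'm) cat \<Rightarrow> ('o, 'm) cat" where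
  "opcat C = \<lparr>obs = obs C, arrs = arrs C, src = tgt C, tgt = src C,
     cmp = (\<lambda>g f. f \<cdot>\<^bsub>C\<^esub> g), idn = idn C\<rparr>"

definition full_subcat :: "('o, 'm) cat \<Rightarrow> 'o set \<Rightarrow> ('o, 'm) cat" where
  "full_subcat C S = C\<lparr>obs := obs C \<inter> S,
     arrs := {f \<in> arrs C. src C f \<in> S \<and> tgt C f \<in> S}\<rparr>"

text \<open>
  A category as a 2-category with only identity 2-morphisms; the identity 2-morphism of \<open>f\<close> is
  encoded by \<open>f\<close> itself.
\<close>

definition disc :: "('o, 'm) cat \<Rightarrow> ('o, 'm, 'm) twocat" where
  "disc C = \<lparr>obs = obs C, arrs = arrs C, src = src C, tgt = tgt C, cmp = cmp C, idn = idn C,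
     cells = arrs C, src2 = (\<lambda>f. f), tgt2 = (\<lambda>f. f), vcmp = (\<lambda>g f. g), hcmp = cmp C,
     idn2 = (\<lambda>f. f)\<rparr>"

text \<open>
  The right cone: a new terminal object \<open>Apex\<close> is adjoined; \<open>Leg a\<close> is the unique arrow from
  (the copy of) \<open>a\<close> to it.
\<close>

datatype 'o cone_ob = Base 'o | Apex

datatype ('o, 'm) cone_arr = Incl 'm | Leg 'o | Apex_id

fun cone_src :: "('o, 'm) cat \<Rightarrow> ('o, 'm) cone_arr \<Rightarrow> 'o cone_ob" where
  "cone_src C (Incl f) = Base (src C f)"
| "cone_src C (Leg a) = Base a"
| "cone_src C Apex_id = Apex"

fun cone_tgt :: "('o, 'm) cat \<Rightarrow> ('o, 'm) cone_arr \<Rightarrow> 'o cone_ob" where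
  "cone_tgt C (Incl f) = Base (tgt C f)"
| "cone_tgt C (Leg a) = Apex"
| "cone_tgt C Apex_id = Apex"

fun cone_cmp :: "('o, 'm) cat \<Rightarrow> ('o, 'm) cone_arr \<Rightarrow> ('o, 'm) cone_arr \<Rightarrow> ('o, 'm) cone_arr" where
  "cone_cmp C (Incl g) (Incl f) = Incl (g \<cdot>\<^bsub>C\<^esub> f)"
| "cone_cmp C (Leg b) (Incl f) = Leg (src C f)"
| "cone_cmp C Apex_id h = h"
| "cone_cmp C _ _ = undefined"

fun cone_idn :: "('o, 'm) cat \<Rightarrow> 'o cone_ob \<Rightarrow> ('o, 'm) cone_arr" where
  "cone_idn C (Base a) = Incl (idn C a)"
| "cone_idn C Apex = Apex_id"

definition right_cone :: "('o, 'm) cat \<Rightarrow> ('o cone_ob, ('o, 'm) cone_arr) cat" where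
  "right_cone C = \<lparr>obs = insert Apex (Base ` obs C),
     arrs = Incl ` arrs C \<union> Leg ` obs C \<union> {Apex_id},
     src = cone_src C, tgt = cone_tgt C, cmp = cone_cmp C, idn = cone_idn C\<rparr>"

text \<open>Restriction along the inclusion of the base (a strict functor) into the right cone.\<close>

definition cone_restrict ::
  "('o cone_ob, ('o, 'm) cone_arr, ('o, 'm) cone_arr, 'p, 'n, 'd) pfun \<Rightarrow>
   ('o, 'm, 'm, 'p, 'n, 'd) pfun" where
  "cone_restrict G = \<lparr>on_ob = (\<lambda>a. on_ob G (Base a)), on_arr = (\<lambda>f. on_arr G (Incl f)),
     on_cell = (\<lambda>f. on_cell G (Incl f)), on_cmp = (\<lambda>g f. on_cmp G (Incl g) (Incl f)),
     on_id = (\<lambda>a. on_id G (Base a))\<rparr>"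

lemma category_opcat:
  assumes "category C"
  shows "category (opcat C)"
proof -
  interpret category C by fact
  have hom: "Hom (opcat C) a b = Hom C b a" for a b
    by (auto simp: opcat_def Hom_def)
  show ?thesis
    unfolding category_def hom
    by (intro conjI allI impI)
      (simp_all add: opcat_def src_ob tgt_ob id_hom cmp_hom id_left id_right assoc)
qed

lemma category_full_subcat:
  assumes "category C"
  shows "category (full_subcat C S)"
proof -
  interpret category C by fact
  have hom: "f \<in> Hom (full_subcat C S) a b \<longleftrightarrow> f \<in> Hom C a b \<and> a \<in> S \<and> b \<in> S" for f a b
    by (auto simp: full_subcat_def Hom_def)
  show ?thesis
    unfolding category_def hom
    by (intro conjI allI impI; (elim conjE)?)
      (simp_all add: full_subcat_def src_ob tgt_ob id_hom cmp_hom id_left id_right assoc)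
qed

lemma two_category_disc:
  assumes "category C"
  shows "two_category (disc C)"
proof -
  interpret category C by fact
  have hom: "Hom (disc C) = Hom C" "Hom (horizontal (disc C)) = Hom C"
    by (simp_all add: fun_eq_iff disc_def Hom_def horizontal_def)
  have vhom: "f \<in> Hom (vertical (disc C)) a b \<longleftrightarrow> f \<in> arrs C \<and> a = f \<and> b = f" for f a b
    by (auto simp: disc_def Hom_def vertical_def)
  have hom2: "\<alpha> \<in> Hom2 (disc C) f g \<longleftrightarrow> \<alpha> \<in> arrs C \<and> f = \<alpha> \<and> g = \<alpha>" for \<alpha> f g
    by (auto simp: disc_def Hom2_def)
  have h_arrs: "f \<in> Hom C a b \<Longrightarrow> f \<in> arrs C" for f a b
    by (simp add: Hom_def)
  have cat: "category (disc C)"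
    unfolding category_def hom
    by (intro conjI allI impI)
      (simp_all add: disc_def src_ob tgt_ob id_hom cmp_hom id_left id_right assoc)
  have vert: "category (vertical (disc C))"
    unfolding category_def vhom
    by (intro conjI allI impI) (simp_all add: disc_def vertical_def)
  have hori: "category (horizontal (disc C))"
    unfolding category_def hom
    by (intro conjI allI impI)
      (simp_all add: disc_def horizontal_def src_ob tgt_ob id_hom cmp_hom id_left id_right assoc)
  show ?thesis
    unfolding two_category_def two_category_axioms_def hom hom2
    by (intro conjI allI impI cat vert hori)
      (auto simp: disc_def intro: h_arrs[OF cmp_hom])
qed

lemma category_right_cone:
  assumes "category C"
  shows "category (right_cone C)"
proof -
  interpret category C by fact
  have hom: "Hom (right_cone C) x y = (case (x, y) of
      (Base a, Base b) \<Rightarrow> Incl ` Hom C a b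
    | (Base a, Apex) \<Rightarrow> (if a \<in> obs C then {Leg a} else {})
    | (Apex, Base b) \<Rightarrow> {}
    | (Apex, Apex) \<Rightarrow> {Apex_id})" for x y
    by (auto simp: right_cone_def Hom_def split: cone_ob.splits)
  have ends: "f \<in> Hom C a b \<Longrightarrow> a \<in> obs C" "f \<in> Hom C a b \<Longrightarrow> src C f = a" for f a b
    using src_ob by (auto simp: Hom_def)
  show ?thesis
  proof
    show "f \<in> arrs (right_cone C) \<Longrightarrow> src (right_cone C) f \<in> obs (right_cone C)"
         "f \<in> arrs (right_cone C) \<Longrightarrow> tgt (right_cone C) f \<in> obs (right_cone C)" for f
      using src_ob tgt_ob by (auto simp: right_cone_def)
  qed (unfold hom, auto simp: right_cone_def ends ends(2)[OF id_hom] ends(2)[OF cmp_hom, symmetric] id_hom cmp_hom id_left id_right assoc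
         split: cone_ob.splits if_splits)
qed

section \<open>The truncated simplex category\<close>

text \<open>
  The object \<open>[n] = {0,\<dots>,n}\<close> is encoded by \<open>n\<close>, and a monotone map \<open>f : [m] \<rightarrow> [n]\<close> by the
  triple \<open>(m, n, f)\<close> with \<open>f\<close> extensional on \<open>{..m}\<close>.
\<close>

type_synonym smap = "nat \<times> nat \<times> (nat \<Rightarrow> nat)"

definition Simplex :: "(nat, smap) cat" where
  "Simplex = \<lparr>obs = UNIV,
     arrs = {(m, n, f). f \<in> {..m} \<rightarrow>\<^sub>E {..n} \<and> mono_on {..m} f},
     src = (\<lambda>(m, n, f). m), tgt = (\<lambda>(m, n, f). n),
     cmp = (\<lambda>(n', p, g) (m, n, f). (m, p, compose {..m} g f)),
     idn = (\<lambda>n. (n, n, \<lambda>x\<in>{..n}. x))\<rparr>"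

text \<open>
  Coface \<open>\<delta>\<^sup>i : [n] \<rightarrow> [n+1]\<close>, omitting \<open>i\<close>, and codegeneracy \<open>\<sigma>\<^sup>i : [n+1] \<rightarrow> [n]\<close>, hitting \<open>i\<close> twice.
\<close>

definition coface :: "nat \<Rightarrow> nat \<Rightarrow> smap" where
  "coface n i = (n, Suc n, \<lambda>x\<in>{..n}. if x < i then x else Suc x)"

definition codegen :: "nat \<Rightarrow> nat \<Rightarrow> smap" where
  "codegen n i = (Suc n, n, \<lambda>x\<in>{..Suc n}. if x \<le> i then x else x - 1)"

lemma category_Simplex: "category Simplex"
proof -
  have hom: "u \<in> Hom Simplex m n \<longleftrightarrow>
      (\<exists>f. u = (m, n, f) \<and> f \<in> {..m} \<rightarrow>\<^sub>E {..n} \<and> mono_on {..m} f)" for u m n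
    by (cases u) (auto simp: Simplex_def Hom_def)
  have cmp_mono: "mono_on {..m} (compose {..m} g f)"
    if "f \<in> {..m} \<rightarrow>\<^sub>E {..n}" "mono_on {..m} f" "mono_on {..n} g" for m n and f g :: "nat \<Rightarrow> nat"
    using that unfolding monotone_on_def compose_def PiE_iff by simp
  have cmp_PiE: "compose {..m} g f \<in> {..m} \<rightarrow>\<^sub>E {..p}"
    if "f \<in> {..m} \<rightarrow>\<^sub>E {..n}" "g \<in> {..n} \<rightarrow>\<^sub>E {..p}" for m n p and f g :: "nat \<Rightarrow> nat"
    using that unfolding compose_def PiE_iff by simp
  have ids: "compose {..m} (\<lambda>x\<in>{..n}. x) f = f" "compose {..m} f (\<lambda>x\<in>{..m}. x) = f"
    if "f \<in> {..m} \<rightarrow>\<^sub>E {..n}" for m n and f :: "nat \<Rightarrow> nat"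
    using that by (auto simp: compose_def PiE_iff extensional_def fun_eq_iff)
  have ass: "compose {..m} (compose {..n} h g) f = compose {..m} h (compose {..m} g f)"
    if "f \<in> {..m} \<rightarrow>\<^sub>E {..n}" for m n and f g h :: "nat \<Rightarrow> nat"
    using that by (auto simp: compose_def PiE_iff fun_eq_iff)
  have idn: "(\<lambda>x\<in>{..n}. x) \<in> {..n} \<rightarrow>\<^sub>E {..n}" "mono_on {..n} (\<lambda>x\<in>{..n}. x)" for n :: nat
    by (simp_all add: monotone_on_def)
  show ?thesis
    unfolding category_def hom
    by (intro conjI allI impI; (elim exE conjE)?)
      (simp_all add: Simplex_def cmp_mono cmp_PiE ids ass idn)
qed

lemma two_category_cone: "two_category (disc (right_cone (opcat (full_subcat Simplex S))))"
  by (intro two_category_disc category_right_cone category_opcat category_full_subcat category_Simplex)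

lemma coface_hom: "coface n i \<in> Hom Simplex n (Suc n)"
  by (auto simp: coface_def Simplex_def Hom_def monotone_on_def)

lemma codegen_hom: "i \<le> n \<Longrightarrow> codegen n i \<in> Hom Simplex (Suc n) n"
  by (auto simp: codegen_def Simplex_def Hom_def monotone_on_def)

abbreviation \<Delta>2op :: "(nat, smap) cat" where
  "\<Delta>2op \<equiv> opcat (full_subcat Simplex {0, 1, 2})"

lemma simplicial_identities:
  "coface 0 0 \<cdot>\<^bsub>\<Delta>2op\<^esub> coface 1 0 = coface 0 0 \<cdot>\<^bsub>\<Delta>2op\<^esub> coface 1 1"
  "coface 0 0 \<cdot>\<^bsub>\<Delta>2op\<^esub> coface 1 2 = coface 0 1 \<cdot>\<^bsub>\<Delta>2op\<^esub> coface 1 0"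
  "coface 0 1 \<cdot>\<^bsub>\<Delta>2op\<^esub> coface 1 1 = coface 0 1 \<cdot>\<^bsub>\<Delta>2op\<^esub> coface 1 2"
  "coface 0 1 \<cdot>\<^bsub>\<Delta>2op\<^esub> codegen 0 0 = idn \<Delta>2op 0"
  "coface 0 0 \<cdot>\<^bsub>\<Delta>2op\<^esub> codegen 0 0 = idn \<Delta>2op 0"
  by (auto simp: opcat_def full_subcat_def Simplex_def coface_def codegen_def compose_def fun_eq_iff)

section \<open>Extensions to the cone\<close>

type_synonym ('p, 'n, 'd) sfun = "(nat, smap, smap, 'p, 'n, 'd) pfun"

type_synonym ('p, 'n, 'd) sfun_ext =
  "(nat cone_ob, (nat, smap) cone_arr, (nat, smap) cone_arr, 'p, 'n, 'd) pfun"

definition extension :: "('p, 'n, 'd) twocat \<Rightarrow> ('p, 'n, 'd) sfun \<Rightarrow> ('p, 'n, 'd) sfun_ext \<Rightarrow> bool"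
  where
  "extension B F G \<longleftrightarrow> pseudofunctor (disc (right_cone \<Delta>2op)) B G \<and>
     pfun_eq (disc \<Delta>2op) (cone_restrict G) F"

text \<open>
  The 2-category of extensions of \<open>F\<close> has as 1-cells the pseudonatural transformations restricting
  to the identity of \<open>F\<close>, and as 2-cells the modifications restricting to the identity
  modification.  Two extensions are equivalent if they are equivalent in this 2-category.
\<close>

definition ptrans_over :: "('p, 'n, 'd) twocat \<Rightarrow> ('p, 'n, 'd) sfun \<Rightarrow>
    (nat cone_ob, (nat, smap) cone_arr, 'n, 'd) ptrans \<Rightarrow> bool" where
  "ptrans_over B F \<sigma> \<longleftrightarrow>
     (\<forall>n\<in>obs \<Delta>2op. at_ob \<sigma> (Base n) = at_ob (ptrans_id B F) n) \<and>
     (\<forall>f\<in>arrs \<Delta>2op. at_arr \<sigma> (Incl f) = at_arr (ptrans_id B F) f)"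

definition modif_over :: "('p, 'n, 'd) twocat \<Rightarrow> ('p, 'n, 'd) sfun \<Rightarrow> (nat cone_ob \<Rightarrow> 'd) \<Rightarrow> bool"
  where
  "modif_over B F \<Gamma> \<longleftrightarrow> (\<forall>n\<in>obs \<Delta>2op. \<Gamma> (Base n) = idn2 B (idn B (on_ob F n)))"

definition equivalent_extensions ::
  "('p, 'n, 'd) twocat \<Rightarrow> ('p, 'n, 'd) sfun \<Rightarrow> ('p, 'n, 'd) sfun_ext \<Rightarrow> ('p, 'n, 'd) sfun_ext \<Rightarrow> bool"
  where
  "equivalent_extensions B F G H \<longleftrightarrow>
     (let K = disc (right_cone \<Delta>2op) in
      \<exists>\<sigma> \<tau> \<Gamma> \<Lambda>.
        pseudonatural K B G H \<sigma> \<and> ptrans_over B F \<sigma> \<and>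
        pseudonatural K B H G \<tau> \<and> ptrans_over B F \<tau> \<and>
        invertible_modification K B G G (ptrans_cmp K B \<tau> \<sigma>) (ptrans_id B G) \<Gamma> \<and>
        modif_over B F \<Gamma> \<and>
        invertible_modification K B H H (ptrans_cmp K B \<sigma> \<tau>) (ptrans_id B H) \<Lambda> \<and>
        modif_over B F \<Lambda>)"

text \<open>
  If \<open>g f = g' f'\<close> in the source, the coherence of \<open>F\<close> gives an invertible 2-cell
  \<open>F g \<cdot> F f \<Rightarrow> F (g f) = F (g' f') \<Rightarrow> F g' \<cdot> F f'\<close>.
\<close>

definition swap :: "('p, 'n, 'd) twocat \<Rightarrow> ('o, 'm, 'c, 'p, 'n, 'd) pfun \<Rightarrow> 'm \<Rightarrow> 'm \<Rightarrow> 'm \<Rightarrow> 'm \<Rightarrow> 'd"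
  where
  "swap B F g f g' f' = inv2 B (on_cmp F g' f') \<bullet>\<^bsub>B\<^esub> on_cmp F g f"

text \<open>
  \<open>d\<^sub>i : B\<^sub>n\<^sub>+\<^sub>1 \<rightarrow> B\<^sub>n\<close> is \<open>face F n i\<close> and \<open>s\<^sub>0 : B\<^sub>0 \<rightarrow> B\<^sub>1\<close> is \<open>degen F 0 0\<close>.
\<close>

definition face :: "('p, 'n, 'd) sfun \<Rightarrow> nat \<Rightarrow> nat \<Rightarrow> 'n" where
  "face F n i = on_arr F (coface n i)"

definition degen :: "('p, 'n, 'd) sfun \<Rightarrow> nat \<Rightarrow> nat \<Rightarrow> 'n" where
  "degen F n i = on_arr F (codegen n i)"

text \<open>
  \<open>\<alpha>\<^sub>0 : d\<^sub>0 d\<^sub>0 \<Rightarrow> d\<^sub>0 d\<^sub>1\<close>, \<open>\<alpha>\<^sub>1 : d\<^sub>0 d\<^sub>2 \<Rightarrow> d\<^sub>1 d\<^sub>0\<close>, \<open>\<alpha>\<^sub>2 : d\<^sub>1 d\<^sub>1 \<Rightarrow> d\<^sub>1 d\<^sub>2\<close>,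
  \<open>\<beta>\<^sub>0 : d\<^sub>1 s\<^sub>0 \<Rightarrow> id\<close>, \<open>\<beta>\<^sub>1 : d\<^sub>0 s\<^sub>0 \<Rightarrow> id\<close>.
\<close>

definition \<alpha>0 :: "('p, 'n, 'd) twocat \<Rightarrow> ('p, 'n, 'd) sfun \<Rightarrow> 'd" where
  "\<alpha>0 B F = swap B F (coface 0 0) (coface 1 0) (coface 0 0) (coface 1 1)"

definition \<alpha>1 :: "('p, 'n, 'd) twocat \<Rightarrow> ('p, 'n, 'd) sfun \<Rightarrow> 'd" where
  "\<alpha>1 B F = swap B F (coface 0 0) (coface 1 2) (coface 0 1) (coface 1 0)"

definition \<alpha>2 :: "('p, 'n, 'd) twocat \<Rightarrow> ('p, 'n, 'd) sfun \<Rightarrow> 'd" where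
  "\<alpha>2 B F = swap B F (coface 0 1) (coface 1 1) (coface 0 1) (coface 1 2)"

definition \<beta>0 :: "('p, 'n, 'd) twocat \<Rightarrow> ('p, 'n, 'd) sfun \<Rightarrow> 'd" where
  "\<beta>0 B F = inv2 B (on_id F 0) \<bullet>\<^bsub>B\<^esub> on_cmp F (coface 0 1) (codegen 0 0)"

definition \<beta>1 :: "('p, 'n, 'd) twocat \<Rightarrow> ('p, 'n, 'd) sfun \<Rightarrow> 'd" where
  "\<beta>1 B F = inv2 B (on_id F 0) \<bullet>\<^bsub>B\<^esub> on_cmp F (coface 0 0) (codegen 0 0)"

definition cone_datum ::
  "('p, 'n, 'd) twocat \<Rightarrow> ('p, 'n, 'd) sfun \<Rightarrow> 'p \<Rightarrow> 'n \<Rightarrow> 'd \<Rightarrow> bool" where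
  "cone_datum B F Bf t0 \<theta> \<longleftrightarrow>
     Bf \<in> obs B \<and>
     t0 \<in> Hom B (on_ob F 0) Bf \<and>
     \<theta> \<in> Iso2 B (t0 \<cdot>\<^bsub>B\<^esub> face F 0 0) (t0 \<cdot>\<^bsub>B\<^esub> face F 0 1) \<and>
     \<theta> \<lhd>\<^bsub>B\<^esub> degen F 0 0 = t0 \<rhd>\<^bsub>B\<^esub> (inv2 B (\<beta>0 B F) \<bullet>\<^bsub>B\<^esub> \<beta>1 B F) \<and>
     (t0 \<rhd>\<^bsub>B\<^esub> inv2 B (\<alpha>1 B F)) \<bullet>\<^bsub>B\<^esub> (\<theta> \<lhd>\<^bsub>B\<^esub> face F 1 0)
       = (inv2 B \<theta> \<lhd>\<^bsub>B\<^esub> face F 1 2) \<bullet>\<^bsub>B\<^esub> (t0 \<rhd>\<^bsub>B\<^esub> \<alpha>2 B F) \<bullet>\<^bsub>B\<^esub>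
         (\<theta> \<lhd>\<^bsub>B\<^esub> face F 1 1) \<bullet>\<^bsub>B\<^esub> (t0 \<rhd>\<^bsub>B\<^esub> \<alpha>0 B F)"

text \<open>
  The datum underlying an extension.  In the cone both composites \<open>[1] \<rightarrow> [0] \<rightarrow> Apex\<close> equal
  \<open>Leg 1\<close>, so the coherence cells compose to \<open>t\<^sub>0 d\<^sub>0 \<Rightarrow> G (Leg 1) \<Rightarrow> t\<^sub>0 d\<^sub>1\<close>.
\<close>

definition ext_apex :: "('p, 'n, 'd) sfun_ext \<Rightarrow> 'p" where
  "ext_apex G = on_ob G Apex"

definition ext_leg :: "('p, 'n, 'd) sfun_ext \<Rightarrow> 'n" where
  "ext_leg G = on_arr G (Leg 0)"

definition ext_theta :: "('p, 'n, 'd) twocat \<Rightarrow> ('p, 'n, 'd) sfun_ext \<Rightarrow> 'd" where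
  "ext_theta B G = swap B G (Leg 0) (Incl (coface 0 0)) (Leg 0) (Incl (coface 0 1))"

end

theory Submission
  imports Defs
begin

text \<open>
  An extension of \<open>F\<close> to the cone adds to \<open>F\<close> an object \<open>B\<^sub>f\<close>, legs \<open>t\<^sub>n : B\<^sub>n \<rightarrow> B\<^sub>f\<close> and, for
  each monotone \<open>f : [m] \<rightarrow> [n]\<close>, an invertible cell \<open>\<phi>\<^sub>f : t\<^sub>m F(f) \<Rightarrow> t\<^sub>n\<close>, compatibly with
  composition and identities (\<open>pseudococone\<close>).  A vertex \<open>x : [0] \<rightarrow> [n]\<close> gives an isomorphism
  \<open>\<phi>\<^sub>x : t\<^sub>0 F(x) \<Rightarrow> t\<^sub>n\<close>, so all legs are determined by \<open>t\<^sub>0\<close> once it is known how the values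
  at different vertices are identified.

  This identification is transport along edges.  The cell \<open>\<theta> : t\<^sub>0 d\<^sub>0 \<Rightarrow> t\<^sub>0 d\<^sub>1\<close>, whiskered with \<open>F(e)\<close>
  for an edge \<open>e\<close> from \<open>x\<close> to \<open>y\<close>, becomes a cell \<open>\<Theta>\<^sub>e : t\<^sub>0 F(y) \<Rightarrow> t\<^sub>0 F(x)\<close> that is natural in \<open>e\<close>.
  Up to conjugation with the coherence cells of \<open>F\<close>, the two equations of the theorem say that \<open>\<Theta>\<close>
  is trivial on the degenerate edge of \<open>[0]\<close> and multiplicative on the triangle \<open>[2]\<close>
  (\<open>degenerate_iff\<close>, \<open>cocycle_iff\<close>); by naturality it is then trivial on all degenerate edges
  and multiplicative on all triangles.

  If \<open>\<theta>\<close> comes from an extension, then \<open>\<Theta>\<^sub>e = \<phi>\<^sub>x\<inverse> \<phi>\<^sub>y\<close> (\<open>\<phi>_\<Theta>\<close>), and such quotients satisfy both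
  equations.  Conversely, for a cocycle \<open>\<Theta>\<close> one takes \<open>t\<^sub>n\<close> to be \<open>t\<^sub>0\<close> at the vertex \<open>0\<close>, and
  \<open>\<phi>\<^sub>f\<close> is forced by its compatibility with the transport to the vertex \<open>0\<close>
  (\<open>leg_cell_to_leg\<close>, \<open>pseudococone_leg\<close>).  Finally, if two extensions have the same \<open>t\<^sub>0\<close> and \<open>\<theta>\<close>,
  then they have the same \<open>\<Theta>\<close>, so the cells \<open>\<phi>'\<^sub>x \<phi>\<^sub>x\<inverse>\<close> between their legs do not depend on the vertex
  \<open>x\<close> (\<open>cocone_comparison\<close>); they form an icon, that is, a transformation with identity
  components, and its inverse is a strict inverse (\<open>equivalent_extensions_of_icon\<close>).
\<close>

section \<open>Calculus of 2-cells\<close>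

context category
begin

lemma cmp_arr:
  assumes "f \<in> arrs C" "g \<in> arrs C" "src C g = tgt C f"
  shows "g \<cdot> f \<in> arrs C" "src C (g \<cdot> f) = src C f" "tgt C (g \<cdot> f) = tgt C g"
  using cmp_hom[of f "src C f" "tgt C f" g "tgt C g"] assms by (auto simp: Hom_def)

lemma cmp_assoc_arr:
  assumes "f \<in> arrs C" "g \<in> arrs C" "h \<in> arrs C" "src C g = tgt C f" "src C h = tgt C g"
  shows "(h \<cdot> g) \<cdot> f = h \<cdot> (g \<cdot> f)"
  using assoc[of f "src C f" "tgt C f" g "tgt C g" h "tgt C h"] assms by (auto simp: Hom_def)

lemma idn_arr:
  assumes "a \<in> obs C"
  shows "idn C a \<in> arrs C" "src C (idn C a) = a" "tgt C (idn C a) = a"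
  using id_hom[OF assms] by (auto simp: Hom_def)

lemma idn_cmp_arr:
  assumes "f \<in> arrs C"
  shows "tgt C f = b \<Longrightarrow> idn C b \<cdot> f = f" "src C f = a \<Longrightarrow> f \<cdot> idn C a = f"
  using id_left[of f "src C f" "tgt C f"] id_right[of f "src C f" "tgt C f"] assms
  by (auto simp: Hom_def)

lemmas arr_simps = src_ob tgt_ob cmp_arr cmp_assoc_arr idn_arr idn_cmp_arr

end

text \<open>
  In the calculations below the boundary of a cell is given by equations for \<open>src2\<close> and \<open>tgt2\<close>
  instead of membership in a hom-set.  The axioms of a 2-category then become conditional rewrite
  rules whose side conditions are found by rewriting.
\<close>

definition isocell :: "('o, 'm, 'c) twocat \<Rightarrow> 'c \<Rightarrow> bool" where
  "isocell B \<alpha> \<longleftrightarrow> \<alpha> \<in> cells B \<and> (\<exists>\<beta>. inverse2 B \<alpha> \<beta>)"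

lemma Iso2_iff: "\<alpha> \<in> Iso2 B f g \<longleftrightarrow> isocell B \<alpha> \<and> src2 B \<alpha> = f \<and> tgt2 B \<alpha> = g"
  by (auto simp: Iso2_def Hom2_def isocell_def)

context two_category
begin

lemma V: "category (vertical B)" and H: "category (horizontal B)"
  by (rule vertical_category horizontal_category)+

lemma cell_ends:
  assumes "\<alpha> \<in> cells B"
  shows "src2 B \<alpha> \<in> arrs B" "tgt2 B \<alpha> \<in> arrs B"
  using category.src_ob[OF V, of \<alpha>] category.tgt_ob[OF V, of \<alpha>] assms
  by (auto simp: vertical_def)

lemma idn2_cell:
  assumes "f \<in> arrs B"
  shows "idn2 B f \<in> cells B" "src2 B (idn2 B f) = f" "tgt2 B (idn2 B f) = f"
  using category.idn_arr[OF V, of f] assms by (auto simp: vertical_def)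

lemma vcmp_cell:
  assumes "\<alpha> \<in> cells B" "\<beta> \<in> cells B" "src2 B \<beta> = tgt2 B \<alpha>"
  shows "\<beta> \<bullet> \<alpha> \<in> cells B" "src2 B (\<beta> \<bullet> \<alpha>) = src2 B \<alpha>" "tgt2 B (\<beta> \<bullet> \<alpha>) = tgt2 B \<beta>"
  using category.cmp_arr[OF V, of \<alpha> \<beta>] assms by (auto simp: vertical_def)

lemma vassoc:
  assumes "\<alpha> \<in> cells B" "\<beta> \<in> cells B" "\<gamma> \<in> cells B" "src2 B \<beta> = tgt2 B \<alpha>" "src2 B \<gamma> = tgt2 B \<beta>"
  shows "\<gamma> \<bullet> \<beta> \<bullet> \<alpha> = \<gamma> \<bullet> (\<beta> \<bullet> \<alpha>)"
  using category.cmp_assoc_arr[OF V, of \<alpha> \<beta> \<gamma>] assms by (auto simp: vertical_def)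

lemma vunit:
  assumes "\<alpha> \<in> cells B"
  shows "tgt2 B \<alpha> = g \<Longrightarrow> idn2 B g \<bullet> \<alpha> = \<alpha>" "src2 B \<alpha> = f \<Longrightarrow> \<alpha> \<bullet> idn2 B f = \<alpha>"
  using category.idn_cmp_arr[OF V, of \<alpha>] assms by (auto simp: vertical_def)

lemma hcmp_cell:
  assumes "\<alpha> \<in> cells B" "\<beta> \<in> cells B" "src B (src2 B \<beta>) = tgt B (src2 B \<alpha>)"
  shows "\<beta> \<star> \<alpha> \<in> cells B" "src2 B (\<beta> \<star> \<alpha>) = src2 B \<beta> \<cdot> src2 B \<alpha>"
    "tgt2 B (\<beta> \<star> \<alpha>) = tgt2 B \<beta> \<cdot> tgt2 B \<alpha>"
  using hcmp_hom2[of "src2 B \<alpha>" _ _ "src2 B \<beta>" _ \<alpha> _ \<beta>] assms cell_ends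
  by (auto simp: Hom_def Hom2_def)

lemma hassoc:
  assumes "\<alpha> \<in> cells B" "\<beta> \<in> cells B" "\<gamma> \<in> cells B"
    "src B (src2 B \<beta>) = tgt B (src2 B \<alpha>)" "src B (src2 B \<gamma>) = tgt B (src2 B \<beta>)"
  shows "\<gamma> \<star> \<beta> \<star> \<alpha> = \<gamma> \<star> (\<beta> \<star> \<alpha>)"
  using category.cmp_assoc_arr[OF H, of \<alpha> \<beta> \<gamma>] assms by (auto simp: horizontal_def)

lemma hunit:
  assumes "\<alpha> \<in> cells B"
  shows "tgt B (src2 B \<alpha>) = b \<Longrightarrow> idn2 B (idn B b) \<star> \<alpha> = \<alpha>"
    "src B (src2 B \<alpha>) = a \<Longrightarrow> \<alpha> \<star> idn2 B (idn B a) = \<alpha>"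
  using category.idn_cmp_arr[OF H, of \<alpha>] assms by (auto simp: horizontal_def)

lemma interchange_cells:
  assumes "\<alpha> \<in> cells B" "\<alpha>' \<in> cells B" "\<beta> \<in> cells B" "\<beta>' \<in> cells B"
    "src2 B \<alpha>' = tgt2 B \<alpha>" "src2 B \<beta>' = tgt2 B \<beta>" "src B (src2 B \<beta>) = tgt B (src2 B \<alpha>)"
  shows "(\<beta>' \<bullet> \<beta>) \<star> (\<alpha>' \<bullet> \<alpha>) = (\<beta>' \<star> \<alpha>') \<bullet> (\<beta> \<star> \<alpha>)"
  using interchange[of "src2 B \<alpha>" _ _ "src2 B \<beta>" _ \<alpha> _ \<alpha>' _ \<beta> _ \<beta>'] assms cell_ends
  by (auto simp: Hom_def Hom2_def)

lemma idn2_hcmp: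
  assumes "f \<in> arrs B" "g \<in> arrs B" "src B g = tgt B f"
  shows "idn2 B g \<star> idn2 B f = idn2 B (g \<cdot> f)"
  using hcmp_idn2[of f _ _ g] assms by (auto simp: Hom_def)

lemma lwhisker_cell:
  assumes "\<alpha> \<in> cells B" "t \<in> arrs B" "src B t = tgt B (src2 B \<alpha>)"
  shows "t \<rhd> \<alpha> \<in> cells B" "src2 B (t \<rhd> \<alpha>) = t \<cdot> src2 B \<alpha>" "tgt2 B (t \<rhd> \<alpha>) = t \<cdot> tgt2 B \<alpha>"
  using hcmp_cell[of \<alpha> "idn2 B t"] assms by (auto simp: lwhisker_def idn2_cell)

lemma rwhisker_cell:
  assumes "\<alpha> \<in> cells B" "f \<in> arrs B" "tgt B f = src B (src2 B \<alpha>)"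
  shows "\<alpha> \<lhd> f \<in> cells B" "src2 B (\<alpha> \<lhd> f) = src2 B \<alpha> \<cdot> f" "tgt2 B (\<alpha> \<lhd> f) = tgt2 B \<alpha> \<cdot> f"
  using hcmp_cell[of "idn2 B f" \<alpha>] assms by (auto simp: rwhisker_def idn2_cell)

lemma lwhisker_vcmp:
  assumes "\<alpha> \<in> cells B" "\<beta> \<in> cells B" "src2 B \<beta> = tgt2 B \<alpha>" "t \<in> arrs B" "src B t = tgt B (src2 B \<alpha>)"
  shows "t \<rhd> (\<beta> \<bullet> \<alpha>) = (t \<rhd> \<beta>) \<bullet> (t \<rhd> \<alpha>)"
  using interchange_cells[of \<alpha> \<beta> "idn2 B t" "idn2 B t"] assms
  by (simp add: lwhisker_def idn2_cell vunit)

lemma rwhisker_vcmp: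
  assumes "\<alpha> \<in> cells B" "\<beta> \<in> cells B" "src2 B \<beta> = tgt2 B \<alpha>" "f \<in> arrs B" "tgt B f = src B (src2 B \<alpha>)"
  shows "(\<beta> \<bullet> \<alpha>) \<lhd> f = (\<beta> \<lhd> f) \<bullet> (\<alpha> \<lhd> f)"
  using interchange_cells[of "idn2 B f" "idn2 B f" \<alpha> \<beta>] assms
  by (simp add: rwhisker_def idn2_cell vunit)

lemma lwhisker_cmp:
  assumes "\<alpha> \<in> cells B" "s \<in> arrs B" "t \<in> arrs B" "src B s = tgt B (src2 B \<alpha>)" "src B t = tgt B s"
  shows "(t \<cdot> s) \<rhd> \<alpha> = t \<rhd> (s \<rhd> \<alpha>)"
  using hassoc[of \<alpha> "idn2 B s" "idn2 B t"] assms
  by (simp add: lwhisker_def idn2_cell idn2_hcmp)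

lemma rwhisker_cmp:
  assumes "\<alpha> \<in> cells B" "f \<in> arrs B" "g \<in> arrs B" "tgt B g = src B (src2 B \<alpha>)" "src B g = tgt B f"
  shows "\<alpha> \<lhd> (g \<cdot> f) = \<alpha> \<lhd> g \<lhd> f"
  using hassoc[of "idn2 B f" "idn2 B g" \<alpha>] assms
  by (simp add: rwhisker_def idn2_cell idn2_hcmp)

lemma lrwhisker:
  assumes "\<alpha> \<in> cells B" "t \<in> arrs B" "f \<in> arrs B" "src B t = tgt B (src2 B \<alpha>)"
    "tgt B f = src B (src2 B \<alpha>)"
  shows "t \<rhd> \<alpha> \<lhd> f = t \<rhd> (\<alpha> \<lhd> f)"
  using hassoc[of "idn2 B f" \<alpha> "idn2 B t"] assms
  by (simp add: rwhisker_def lwhisker_def idn2_cell)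

lemma whisker_idn2:
  assumes "f \<in> arrs B" "g \<in> arrs B" "src B g = tgt B f"
  shows "g \<rhd> idn2 B f = idn2 B (g \<cdot> f)" "idn2 B g \<lhd> f = idn2 B (g \<cdot> f)"
  using assms by (simp_all add: rwhisker_def lwhisker_def idn2_hcmp)

lemma whisker_idn:
  assumes "\<alpha> \<in> cells B"
  shows "tgt B (src2 B \<alpha>) = b \<Longrightarrow> idn B b \<rhd> \<alpha> = \<alpha>" "src B (src2 B \<alpha>) = a \<Longrightarrow> \<alpha> \<lhd> idn B a = \<alpha>"
  using assms by (simp_all add: rwhisker_def lwhisker_def hunit)

text \<open>
  Both sides are the horizontal composite \<open>\<beta> \<star> \<alpha>\<close>.
\<close>

lemma whisker_exchange:
  assumes "\<alpha> \<in> cells B" "\<beta> \<in> cells B" "src2 B \<alpha> = f" "tgt2 B \<alpha> = f'"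
    "src2 B \<beta> = g" "tgt2 B \<beta> = g'" "src B g = tgt B f"
  shows "(\<beta> \<lhd> f') \<bullet> (g \<rhd> \<alpha>) = (g' \<rhd> \<alpha>) \<bullet> (\<beta> \<lhd> f)"
  using interchange_cells[of \<alpha> "idn2 B f'" "idn2 B g" \<beta>]
    interchange_cells[of "idn2 B f" \<alpha> \<beta> "idn2 B g'"] assms
  by (auto simp: rwhisker_def lwhisker_def idn2_cell vunit cell_ends globular_tgt globular_src)

lemma inverse2_unique:
  assumes "\<alpha> \<in> cells B" "inverse2 B \<alpha> \<beta>" "inverse2 B \<alpha> \<gamma>"
  shows "\<beta> = \<gamma>"
proof -
  have "\<beta> = \<beta> \<bullet> (\<alpha> \<bullet> \<gamma>)" "\<gamma> = \<beta> \<bullet> \<alpha> \<bullet> \<gamma>"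
    using assms by (auto simp: inverse2_def Hom2_def vunit)
  then show ?thesis
    using assms vassoc[of \<gamma> \<alpha> \<beta>] by (auto simp: inverse2_def Hom2_def)
qed

lemma inv2_eqI:
  assumes "\<alpha> \<in> cells B" "\<beta> \<in> cells B" "src2 B \<beta> = tgt2 B \<alpha>" "tgt2 B \<beta> = src2 B \<alpha>"
    "\<beta> \<bullet> \<alpha> = idn2 B (src2 B \<alpha>)" "\<alpha> \<bullet> \<beta> = idn2 B (tgt2 B \<alpha>)"
  shows "isocell B \<alpha>" "inv2 B \<alpha> = \<beta>"
proof -
  have "inverse2 B \<alpha> \<beta>" using assms by (simp add: inverse2_def Hom2_def)
  then show "isocell B \<alpha>" "inv2 B \<alpha> = \<beta>"
    using inverse2_unique[OF assms(1)] assms(1) unfolding inv2_def isocell_def by blast+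
qed

lemma isocell_inv2:
  assumes "isocell B \<alpha>"
  shows "\<alpha> \<in> cells B" "inv2 B \<alpha> \<in> cells B"
    "src2 B (inv2 B \<alpha>) = tgt2 B \<alpha>" "tgt2 B (inv2 B \<alpha>) = src2 B \<alpha>"
    "inv2 B \<alpha> \<bullet> \<alpha> = idn2 B (src2 B \<alpha>)" "\<alpha> \<bullet> inv2 B \<alpha> = idn2 B (tgt2 B \<alpha>)"
proof -
  obtain \<beta> where \<beta>: "inverse2 B \<alpha> \<beta>" and \<alpha>: "\<alpha> \<in> cells B"
    using assms unfolding isocell_def by auto
  have "inverse2 B \<alpha> (inv2 B \<alpha>)"
    unfolding inv2_def by (rule theI[where P = "inverse2 B \<alpha>", OF \<beta>]) (rule inverse2_unique[OF \<alpha> _ \<beta>])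
  then show "\<alpha> \<in> cells B" "inv2 B \<alpha> \<in> cells B"
    "src2 B (inv2 B \<alpha>) = tgt2 B \<alpha>" "tgt2 B (inv2 B \<alpha>) = src2 B \<alpha>"
    "inv2 B \<alpha> \<bullet> \<alpha> = idn2 B (src2 B \<alpha>)" "\<alpha> \<bullet> inv2 B \<alpha> = idn2 B (tgt2 B \<alpha>)"
    using \<alpha> by (auto simp: inverse2_def Hom2_def)
qed

lemma inv2_cancel:
  assumes "isocell B \<alpha>" "\<gamma> \<in> cells B"
  shows "tgt2 B \<gamma> = src2 B \<alpha> \<Longrightarrow> inv2 B \<alpha> \<bullet> (\<alpha> \<bullet> \<gamma>) = \<gamma>"
    "tgt2 B \<gamma> = tgt2 B \<alpha> \<Longrightarrow> \<alpha> \<bullet> (inv2 B \<alpha> \<bullet> \<gamma>) = \<gamma>"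
  using assms by (simp_all add: vassoc[symmetric] isocell_inv2 vunit)

lemma isocell_idn2:
  assumes "f \<in> arrs B"
  shows "isocell B (idn2 B f)" "inv2 B (idn2 B f) = idn2 B f"
  using inv2_eqI[of "idn2 B f" "idn2 B f"] assms by (simp_all add: idn2_cell vunit)

lemma isocell_inv2_inv2:
  assumes "isocell B \<alpha>"
  shows "isocell B (inv2 B \<alpha>)" "inv2 B (inv2 B \<alpha>) = \<alpha>"
  using inv2_eqI[of "inv2 B \<alpha>" \<alpha>] assms by (simp_all add: isocell_inv2)

lemma isocell_vcmp:
  assumes "isocell B \<alpha>" "isocell B \<beta>" "src2 B \<beta> = tgt2 B \<alpha>"
  shows "isocell B (\<beta> \<bullet> \<alpha>)" "inv2 B (\<beta> \<bullet> \<alpha>) = inv2 B \<alpha> \<bullet> inv2 B \<beta>"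
  using inv2_eqI[of "\<beta> \<bullet> \<alpha>" "inv2 B \<alpha> \<bullet> inv2 B \<beta>"] assms
  by (simp_all add: isocell_inv2 vcmp_cell vassoc inv2_cancel)

lemma isocell_lwhisker:
  assumes "isocell B \<alpha>" "t \<in> arrs B" "src B t = tgt B (src2 B \<alpha>)"
  shows "isocell B (t \<rhd> \<alpha>)" "inv2 B (t \<rhd> \<alpha>) = t \<rhd> inv2 B \<alpha>"
proof -
  have \<alpha>: "\<alpha> \<in> cells B" using assms by (simp add: isocell_def)
  then show "isocell B (t \<rhd> \<alpha>)" "inv2 B (t \<rhd> \<alpha>) = t \<rhd> inv2 B \<alpha>"
    using inv2_eqI[of "t \<rhd> \<alpha>" "t \<rhd> inv2 B \<alpha>"] assms
    by (simp_all add: isocell_inv2 lwhisker_cell lwhisker_vcmp[symmetric] globular_tgt whisker_idn2 cell_ends)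
qed

lemma isocell_rwhisker:
  assumes "isocell B \<alpha>" "f \<in> arrs B" "tgt B f = src B (src2 B \<alpha>)"
  shows "isocell B (\<alpha> \<lhd> f)" "inv2 B (\<alpha> \<lhd> f) = inv2 B \<alpha> \<lhd> f"
proof -
  have \<alpha>: "\<alpha> \<in> cells B" using assms by (simp add: isocell_def)
  then show "isocell B (\<alpha> \<lhd> f)" "inv2 B (\<alpha> \<lhd> f) = inv2 B \<alpha> \<lhd> f"
    using inv2_eqI[of "\<alpha> \<lhd> f" "inv2 B \<alpha> \<lhd> f"] assms
    by (simp_all add: isocell_inv2 rwhisker_cell rwhisker_vcmp[symmetric] globular_src whisker_idn2 cell_ends)
qed

lemmas iso_simps = isocell_inv2 inv2_cancel isocell_idn2 isocell_inv2_inv2 isocell_vcmp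
  isocell_lwhisker(1) isocell_rwhisker(1) isocell_lwhisker(2)[symmetric] isocell_rwhisker(2)[symmetric]

text \<open>
  A rewrite system for pasting diagrams: vertical composites are nested to the right, whiskerings by
  a composite 1-cell are split, whiskerings distribute over vertical composites, and inverses are
  pulled out of whiskerings, where they meet the cell that they cancel.
\<close>

lemmas cell_simps = arr_simps cell_ends globular_src globular_tgt idn2_cell vcmp_cell vassoc vunit
  lwhisker_cell rwhisker_cell lwhisker_vcmp rwhisker_vcmp lwhisker_cmp rwhisker_cmp lrwhisker
  whisker_idn2 whisker_idn iso_simps

lemma inv2_swap:
  assumes "isocell B \<alpha>" "isocell B \<delta>" "\<beta> \<in> cells B" "\<gamma> \<in> cells B" "src2 B \<alpha> = tgt2 B \<beta>"
    "src2 B \<gamma> = tgt2 B \<delta>" "\<alpha> \<bullet> \<beta> = \<gamma> \<bullet> \<delta>"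
  shows "inv2 B \<alpha> \<bullet> \<gamma> = \<beta> \<bullet> inv2 B \<delta>"
proof -
  have ends: "tgt2 B \<gamma> = tgt2 B \<alpha>" "src2 B \<delta> = src2 B \<beta>"
    using arg_cong[OF assms(7), of "tgt2 B"] arg_cong[OF assms(7), of "src2 B"] assms(1-6)
    by (simp_all add: cell_simps)
  have "inv2 B \<alpha> \<bullet> \<gamma> = inv2 B \<alpha> \<bullet> (\<gamma> \<bullet> \<delta> \<bullet> inv2 B \<delta>)"
    using assms(1-6) ends by (simp add: cell_simps)
  also have "\<dots> = inv2 B \<alpha> \<bullet> (\<alpha> \<bullet> \<beta> \<bullet> inv2 B \<delta>)"
    by (simp add: assms(7))
  also have "\<dots> = \<beta> \<bullet> inv2 B \<delta>"
    using assms(1-6) ends by (simp add: cell_simps)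
  finally show ?thesis .
qed

lemma iso_cancel_left:
  assumes "isocell B \<alpha>" "\<beta> \<in> cells B" "\<gamma> \<in> cells B" "tgt2 B \<beta> = src2 B \<alpha>" "tgt2 B \<gamma> = src2 B \<alpha>"
    "\<alpha> \<bullet> \<beta> = \<alpha> \<bullet> \<gamma>"
  shows "\<beta> = \<gamma>"
proof -
  have "inv2 B \<alpha> \<bullet> (\<alpha> \<bullet> \<beta>) = \<beta>" "inv2 B \<alpha> \<bullet> (\<alpha> \<bullet> \<gamma>) = \<gamma>"
    using assms(1-5) by (simp_all add: inv2_cancel)
  then show ?thesis using assms(6) by metis
qed

lemma iso_cancel_right:
  assumes "isocell B \<alpha>" "\<beta> \<in> cells B" "\<gamma> \<in> cells B" "src2 B \<beta> = tgt2 B \<alpha>" "src2 B \<gamma> = tgt2 B \<alpha>"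
    "\<beta> \<bullet> \<alpha> = \<gamma> \<bullet> \<alpha>"
  shows "\<beta> = \<gamma>"
proof -
  have "\<beta> \<bullet> \<alpha> \<bullet> inv2 B \<alpha> = \<beta>" "\<gamma> \<bullet> \<alpha> \<bullet> inv2 B \<alpha> = \<gamma>"
    using assms(1-5) by (simp_all add: cell_simps)
  then show ?thesis using assms(6) by metis
qed

end

section \<open>Pseudofunctors out of a category\<close>

text \<open>
  If the source has only identity 2-cells, then the action of a pseudofunctor on 2-cells is forced
  and the naturality of its coherence cells is automatic.  What remains is stated here.
\<close>

locale disc_pseudofunctor = C: category C + two_category B
  for C :: "('o, 'm) cat" and B :: "('p, 'n, 'd) twocat" (structure) +
  fixes F :: "('o, 'm, 'm, 'p, 'n, 'd) pfun"
  assumes F_ob: "a \<in> obs C \<Longrightarrow> on_ob F a \<in> obs B"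
    and F_arr: "f \<in> arrs C \<Longrightarrow> on_arr F f \<in> arrs B"
      "f \<in> arrs C \<Longrightarrow> src B (on_arr F f) = on_ob F (src C f)"
      "f \<in> arrs C \<Longrightarrow> tgt B (on_arr F f) = on_ob F (tgt C f)"
    and F_cell: "f \<in> arrs C \<Longrightarrow> on_cell F f = idn2 B (on_arr F f)"
    and F_cmp: "\<lbrakk>f \<in> arrs C; g \<in> arrs C; src C g = tgt C f\<rbrakk> \<Longrightarrow> isocell B (on_cmp F g f)"
      "\<lbrakk>f \<in> arrs C; g \<in> arrs C; src C g = tgt C f\<rbrakk>
        \<Longrightarrow> src2 B (on_cmp F g f) = on_arr F g \<cdot> on_arr F f"
      "\<lbrakk>f \<in> arrs C; g \<in> arrs C; src C g = tgt C f\<rbrakk>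
        \<Longrightarrow> tgt2 B (on_cmp F g f) = on_arr F (g \<cdot>\<^bsub>C\<^esub> f)"
    and F_id: "a \<in> obs C \<Longrightarrow> isocell B (on_id F a)"
      "a \<in> obs C \<Longrightarrow> src2 B (on_id F a) = idn B (on_ob F a)"
      "a \<in> obs C \<Longrightarrow> tgt2 B (on_id F a) = on_arr F (idn C a)"
    and F_assoc: "\<lbrakk>f \<in> arrs C; g \<in> arrs C; h \<in> arrs C; src C g = tgt C f; src C h = tgt C g\<rbrakk>
      \<Longrightarrow> on_cmp F (h \<cdot>\<^bsub>C\<^esub> g) f \<bullet> (on_cmp F h g \<lhd> on_arr F f)
          = on_cmp F h (g \<cdot>\<^bsub>C\<^esub> f) \<bullet> (on_arr F h \<rhd> on_cmp F g f)"
    and F_unit_right: "f \<in> arrs C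
      \<Longrightarrow> on_cmp F f (idn C (src C f)) \<bullet> (on_arr F f \<rhd> on_id F (src C f)) = idn2 B (on_arr F f)"
    and F_unit_left: "f \<in> arrs C
      \<Longrightarrow> on_cmp F (idn C (tgt C f)) f \<bullet> (on_id F (tgt C f) \<lhd> on_arr F f) = idn2 B (on_arr F f)"
begin

lemma F_cmp_cell:
  assumes "f \<in> arrs C" "g \<in> arrs C" "src C g = tgt C f"
  shows "on_cmp F g f \<in> cells B"
  using F_cmp(1)[OF assms] by (simp add: isocell_def)

lemma F_id_cell: "a \<in> obs C \<Longrightarrow> on_id F a \<in> cells B"
  using F_id(1) by (simp add: isocell_def)

lemmas F_simps = F_ob F_arr F_cmp F_cmp_cell F_id F_id_cell

end

lemma disc_sel:
  "obs (disc C) = obs C" "arrs (disc C) = arrs C" "src (disc C) = src C" "tgt (disc C) = tgt C"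
  "cmp (disc C) = cmp C" "idn (disc C) = idn C" "Hom (disc C) = Hom C"
  "cells (disc C) = arrs C" "src2 (disc C) f = f" "tgt2 (disc C) f = f" "idn2 (disc C) f = f" "vcmp (disc C) g f = g" "hcmp (disc C) = cmp C"
  by (simp_all add: disc_def Hom_def fun_eq_iff)

lemma Hom2_disc: "\<phi> \<in> Hom2 (disc C) f g \<longleftrightarrow> \<phi> \<in> arrs C \<and> f = \<phi> \<and> g = \<phi>"
  by (auto simp: disc_def Hom2_def)

lemma pseudofunctor_disc_iff:
  assumes C: "category C"
  shows "pseudofunctor (disc C) B F \<longleftrightarrow> disc_pseudofunctor C B F"
proof
  assume "pseudofunctor (disc C) B F"
  then interpret pseudofunctor "disc C" B F .
  interpret C: category C by (fact C)
  have hom: "f \<in> Hom C (src C f) (tgt C f)" if "f \<in> arrs C" for f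
    using that by (simp add: Hom_def)
  note sel = disc_sel Hom2_disc Iso2_iff
  show "disc_pseudofunctor C B F"
  proof
    fix a assume a: "a \<in> obs C"
    show "on_ob F a \<in> obs B" "isocell B (on_id F a)"
      "src2 B (on_id F a) = idn B (on_ob F a)" "tgt2 B (on_id F a) = on_arr F (idn C a)"
      using ob[of a] id_iso[of a] a by (simp_all add: sel)
  next
    fix f assume f: "f \<in> arrs C"
    show "on_arr F f \<in> arrs B" "src B (on_arr F f) = on_ob F (src C f)"
      "tgt B (on_arr F f) = on_ob F (tgt C f)"
      using arr[of f "src C f" "tgt C f"] f by (simp_all add: sel Hom_def)
    show "on_cell F f = idn2 B (on_arr F f)"
      using cell_idn2[of f] f by (simp add: sel)
    show "on_cmp F f (idn C (src C f)) \<bullet>\<^bsub>B\<^esub> (on_arr F f \<rhd>\<^bsub>B\<^esub> on_id F (src C f)) = idn2 B (on_arr F f)"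
      "on_cmp F (idn C (tgt C f)) f \<bullet>\<^bsub>B\<^esub> (on_id F (tgt C f) \<lhd>\<^bsub>B\<^esub> on_arr F f) = idn2 B (on_arr F f)"
      using unit_right[unfolded sel, OF hom[OF f]] unit_left[unfolded sel, OF hom[OF f]] by simp_all
    fix g assume g: "g \<in> arrs C" "src C g = tgt C f"
    show "isocell B (on_cmp F g f)" "src2 B (on_cmp F g f) = on_arr F g \<cdot>\<^bsub>B\<^esub> on_arr F f"
      "tgt2 B (on_cmp F g f) = on_arr F (g \<cdot>\<^bsub>C\<^esub> f)"
      using cmp_iso[of f "src C f" "tgt C f" g "tgt C g"] f g by (simp_all add: sel Hom_def)
    fix h assume h: "h \<in> arrs C" "src C h = tgt C g"
    show "on_cmp F (h \<cdot>\<^bsub>C\<^esub> g) f \<bullet>\<^bsub>B\<^esub> (on_cmp F h g \<lhd>\<^bsub>B\<^esub> on_arr F f)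
          = on_cmp F h (g \<cdot>\<^bsub>C\<^esub> f) \<bullet>\<^bsub>B\<^esub> (on_arr F h \<rhd>\<^bsub>B\<^esub> on_cmp F g f)"
      using cmp_assoc[of f "src C f" "tgt C f" g "tgt C g" h "tgt C h"] f g h
      by (simp add: sel Hom_def)
  qed
next
  assume "disc_pseudofunctor C B F"
  then interpret disc_pseudofunctor C B F .
  note sel = disc_sel Hom2_disc Iso2_iff Hom_def
  show "pseudofunctor (disc C) B F"
    unfolding pseudofunctor_def pseudofunctor_axioms_def
    by (intro conjI allI impI two_category_disc C two_category_axioms)
      (auto simp: sel F_simps F_cell Hom2_def F_assoc F_unit_right F_unit_left idn2_cell vunit
        idn2_hcmp C.cmp_arr cell_ends)
qed

section \<open>Extensions to the cone as pseudococones\<close>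

text \<open>
  The data that an extension to the cone adds to \<open>F\<close>, apart from the image of the identity of the apex:
  \<open>t a\<close> is the image of \<open>Leg a\<close>, and \<open>\<phi> f\<close> is the coherence cell of the composite
  \<open>Leg (tgt f) \<cdot> Incl f = Leg (src f)\<close>.
\<close>

locale pseudococone = disc_pseudofunctor C B F
  for C :: "('o, 'm) cat" and B :: "('p, 'n, 'd) twocat" (structure)
    and F :: "('o, 'm, 'm, 'p, 'n, 'd) pfun" +
  fixes X :: 'p and t :: "'o \<Rightarrow> 'n" and \<phi> :: "'m \<Rightarrow> 'd"
  assumes X_ob: "X \<in> obs B"
    and t_arr: "a \<in> obs C \<Longrightarrow> t a \<in> arrs B" "a \<in> obs C \<Longrightarrow> src B (t a) = on_ob F a"
      "a \<in> obs C \<Longrightarrow> tgt B (t a) = X"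
    and \<phi>_iso: "f \<in> arrs C \<Longrightarrow> isocell B (\<phi> f)"
      "f \<in> arrs C \<Longrightarrow> src2 B (\<phi> f) = t (tgt C f) \<cdot> on_arr F f"
      "f \<in> arrs C \<Longrightarrow> tgt2 B (\<phi> f) = t (src C f)"
    and \<phi>_cmp: "\<lbrakk>f \<in> arrs C; g \<in> arrs C; src C g = tgt C f\<rbrakk>
      \<Longrightarrow> \<phi> f \<bullet> (\<phi> g \<lhd> on_arr F f) = \<phi> (g \<cdot>\<^bsub>C\<^esub> f) \<bullet> (t (tgt C g) \<rhd> on_cmp F g f)"
    and \<phi>_id: "a \<in> obs C \<Longrightarrow> \<phi> (idn C a) \<bullet> (t a \<rhd> on_id F a) = idn2 B (t a)"
begin

lemma \<phi>_cell: "f \<in> arrs C \<Longrightarrow> \<phi> f \<in> cells B"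
  using \<phi>_iso(1) by (simp add: isocell_def)

lemmas \<phi>_simps = X_ob t_arr \<phi>_iso \<phi>_cell

text \<open>
  The identity of the apex is preserved strictly, which makes all coherence cells at
  \<open>Apex_id\<close> identities.
\<close>

definition cone_ext :: "('o cone_ob, ('o, 'm) cone_arr, ('o, 'm) cone_arr, 'p, 'n, 'd) pfun" where
  "cone_ext =
    (let arr = (\<lambda>h. case h of Incl f \<Rightarrow> on_arr F f | Leg a \<Rightarrow> t a | Apex_id \<Rightarrow> idn B X) in
     \<lparr>on_ob = (\<lambda>x. case x of Base a \<Rightarrow> on_ob F a | Apex \<Rightarrow> X),
      on_arr = arr,
      on_cell = (\<lambda>h. case h of Incl f \<Rightarrow> on_cell F f | _ \<Rightarrow> idn2 B (arr h)),
      on_cmp = (\<lambda>h k. case (h, k) of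
          (Incl g, Incl f) \<Rightarrow> on_cmp F g f
        | (Leg b, Incl f) \<Rightarrow> \<phi> f
        | _ \<Rightarrow> idn2 B (arr k)),
      on_id = (\<lambda>x. case x of Base a \<Rightarrow> on_id F a | Apex \<Rightarrow> idn2 B (idn B X))\<rparr>)"

lemma disc_pseudofunctor_cone_ext: "disc_pseudofunctor (right_cone C) B cone_ext"
proof -
  have K: "category (right_cone C)" by (rule category_right_cone) (fact C.category_axioms)
  note arrs = right_cone_def cone_ext_def Let_def F_simps \<phi>_simps
  show ?thesis
    unfolding disc_pseudofunctor_def disc_pseudofunctor_axioms_def
    by (intro conjI allI impI K two_category_axioms)
      (auto simp: arrs F_cell F_assoc F_unit_right F_unit_left \<phi>_cmp \<phi>_id C.arr_simps cell_simps)
qed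

lemma cone_ext_restrict: "pfun_eq (disc C) (cone_restrict cone_ext) F"
  by (simp add: pfun_eq_def cone_restrict_def cone_ext_def Let_def disc_sel)

end

lemma right_cone_sel:
  "Apex \<in> obs (right_cone C)" "Apex_id \<in> arrs (right_cone C)"
  "a \<in> obs C \<Longrightarrow> Base a \<in> obs (right_cone C)" "a \<in> obs C \<Longrightarrow> Leg a \<in> arrs (right_cone C)"
  "f \<in> arrs C \<Longrightarrow> Incl f \<in> arrs (right_cone C)"
  "src (right_cone C) = cone_src C" "tgt (right_cone C) = cone_tgt C"
  "cmp (right_cone C) = cone_cmp C" "idn (right_cone C) = cone_idn C"
  by (simp_all add: right_cone_def)

lemma pfun_eq_disc_cone_restrict:
  assumes "pfun_eq (disc C) (cone_restrict G) F"
  shows "a \<in> obs C \<Longrightarrow> on_ob G (Base a) = on_ob F a"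
    "f \<in> arrs C \<Longrightarrow> on_arr G (Incl f) = on_arr F f"
    "\<lbrakk>f \<in> arrs C; g \<in> arrs C; src C g = tgt C f\<rbrakk> \<Longrightarrow> on_cmp G (Incl g) (Incl f) = on_cmp F g f"
    "a \<in> obs C \<Longrightarrow> on_id G (Base a) = on_id F a"
  using assms by (auto simp: pfun_eq_def cone_restrict_def disc_sel)

text \<open>
  The two laws of a pseudococone are the associativity law of \<open>G\<close> at \<open>Leg \<cdot> Incl g \<cdot> Incl f\<close> and its
  right unit law at \<open>Leg a\<close>.
\<close>

lemma pseudococone_of_extension:
  assumes F: "disc_pseudofunctor C B F" and G: "disc_pseudofunctor (right_cone C) B G"
    and eq: "pfun_eq (disc C) (cone_restrict G) F"
  shows "pseudococone C B F (on_ob G Apex) (\<lambda>a. on_arr G (Leg a))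
    (\<lambda>f. on_cmp G (Leg (tgt C f)) (Incl f))"
proof -
  interpret F: disc_pseudofunctor C B F by fact
  interpret G: disc_pseudofunctor "right_cone C" B G by fact
  note K = right_cone_sel
  note simps = K pfun_eq_disc_cone_restrict[OF eq] G.F_simps F.C.arr_simps
  show ?thesis
  proof
    fix a assume a: "a \<in> obs C"
    show "on_cmp G (Leg (tgt C (idn C a))) (Incl (idn C a)) \<bullet>\<^bsub>B\<^esub> (on_arr G (Leg a) \<rhd>\<^bsub>B\<^esub> on_id F a)
        = idn2 B (on_arr G (Leg a))"
      using G.F_unit_right[of "Leg a"] a by (simp add: simps)
  next
    fix f g assume "f \<in> arrs C" "g \<in> arrs C" "src C g = tgt C f"
    then show "on_cmp G (Leg (tgt C f)) (Incl f) \<bullet>\<^bsub>B\<^esub>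
         (on_cmp G (Leg (tgt C g)) (Incl g) \<lhd>\<^bsub>B\<^esub> on_arr F f)
        = on_cmp G (Leg (tgt C (g \<cdot>\<^bsub>C\<^esub> f))) (Incl (g \<cdot>\<^bsub>C\<^esub> f)) \<bullet>\<^bsub>B\<^esub>
         (on_arr G (Leg (tgt C g)) \<rhd>\<^bsub>B\<^esub> on_cmp F g f)"
      using G.F_assoc[of "Incl f" "Incl g" "Leg (tgt C g)"] by (simp add: simps)
  qed (use G.F_arr in \<open>simp_all add: simps\<close>)
qed

section \<open>Icons and equivalences of extensions\<close>

text \<open>
  An invertible icon: a comparison of two pseudofunctors that agree on objects, through cells between
  their values on arrows.  The cell of a pseudonatural transformation \<open>\<sigma>\<close> at \<open>f\<close> starts at the target
  functor of \<open>\<sigma>\<close>, so an icon from \<open>G\<close> to \<open>H\<close> is a pseudonatural transformation from \<open>H\<close> to \<open>G\<close> with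
  identity components.
\<close>

locale icon = G: disc_pseudofunctor C B G + H: disc_pseudofunctor C B H
  for C :: "('o, 'm) cat" and B :: "('p, 'n, 'd) twocat" (structure)
    and G H :: "('o, 'm, 'm, 'p, 'n, 'd) pfun" +
  fixes \<psi> :: "'m \<Rightarrow> 'd"
  assumes same_ob: "a \<in> obs C \<Longrightarrow> on_ob G a = on_ob H a"
    and \<psi>_iso: "f \<in> arrs C \<Longrightarrow> isocell B (\<psi> f)" "f \<in> arrs C \<Longrightarrow> src2 B (\<psi> f) = on_arr G f"
      "f \<in> arrs C \<Longrightarrow> tgt2 B (\<psi> f) = on_arr H f"
    and \<psi>_cmp: "\<lbrakk>f \<in> arrs C; g \<in> arrs C; src C g = tgt C f\<rbrakk>
      \<Longrightarrow> \<psi> (g \<cdot>\<^bsub>C\<^esub> f) \<bullet> on_cmp G g f = on_cmp H g f \<bullet> (\<psi> g \<lhd> on_arr H f) \<bullet> (on_arr G g \<rhd> \<psi> f)"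
    and \<psi>_id: "a \<in> obs C \<Longrightarrow> \<psi> (idn C a) \<bullet> on_id G a = on_id H a"
begin

lemma \<psi>_cell: "f \<in> arrs C \<Longrightarrow> \<psi> f \<in> cells B"
  using \<psi>_iso(1) by (simp add: isocell_def)

lemmas \<psi>_simps = \<psi>_iso \<psi>_cell

lemma pseudonatural_icon:
  assumes "\<And>a. a \<in> obs C \<Longrightarrow> at_ob \<sigma> a = idn B (on_ob G a)" "\<And>f. f \<in> arrs C \<Longrightarrow> at_arr \<sigma> f = \<psi> f"
  shows "pseudonatural (disc C) B H G \<sigma>"
proof -
  have PG: "pseudofunctor (disc C) B G" and PH: "pseudofunctor (disc C) B H"
    using G.disc_pseudofunctor_axioms H.disc_pseudofunctor_axioms
      pseudofunctor_disc_iff[OF G.C.category_axioms] by blast+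
  show ?thesis
    unfolding pseudonatural_def pseudonatural_axioms_def
    by (intro conjI allI impI PG PH)
      (auto simp: disc_sel Hom_def Hom2_disc Iso2_iff assms same_ob G.C.arr_simps H.F_simps G.F_simps
        H.F_cell G.F_cell \<psi>_simps \<psi>_cmp \<psi>_id G.cell_simps)
qed

lemma icon_inverse: "icon C B H G (\<lambda>f. inv2 B (\<psi> f))"
proof -
  have "inv2 B (\<psi> (g \<cdot>\<^bsub>C\<^esub> f)) \<bullet> on_cmp H g f =
      on_cmp G g f \<bullet> (inv2 B (\<psi> g) \<lhd> on_arr G f) \<bullet> (on_arr H g \<rhd> inv2 B (\<psi> f))"
    if fg: "f \<in> arrs C" "g \<in> arrs C" "src C g = tgt C f" for f g
  proof -
    note simps = fg same_ob G.C.arr_simps H.F_simps G.F_simps \<psi>_simps G.cell_simps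
    have "inv2 B (\<psi> (g \<cdot>\<^bsub>C\<^esub> f)) \<bullet> on_cmp H g f =
        on_cmp G g f \<bullet> inv2 B ((\<psi> g \<lhd> on_arr H f) \<bullet> (on_arr G g \<rhd> \<psi> f))"
      using \<psi>_cmp[OF fg] by (intro G.inv2_swap) (simp_all add: simps)
    moreover have "(inv2 B (\<psi> g) \<lhd> on_arr G f) \<bullet> (on_arr H g \<rhd> inv2 B (\<psi> f)) =
        (on_arr G g \<rhd> inv2 B (\<psi> f)) \<bullet> (inv2 B (\<psi> g) \<lhd> on_arr H f)"
      by (rule G.whisker_exchange) (simp_all add: simps)
    ultimately show ?thesis by (simp add: simps)
  qed
  moreover have "inv2 B (\<psi> (idn C a)) \<bullet> on_id H a = on_id G a" if "a \<in> obs C" for a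
    using that by (simp add: \<psi>_id[symmetric] G.C.arr_simps G.F_simps \<psi>_simps G.cell_simps)
  ultimately show ?thesis
    by unfold_locales (simp_all add: same_ob \<psi>_simps G.cell_simps)
qed

end

lemma icon_idn2:
  assumes "disc_pseudofunctor C B G"
  shows "icon C B G G (\<lambda>f. idn2 B (on_arr G f))"
proof -
  interpret disc_pseudofunctor C B G by fact
  show ?thesis by unfold_locales (simp_all add: F_simps C.arr_simps cell_simps)
qed

lemma (in disc_pseudofunctor) on_cmp_idn_left:
  assumes f: "f \<in> arrs C"
  shows "on_cmp F (idn C (tgt C f)) f = inv2 B (on_id F (tgt C f)) \<lhd> on_arr F f"
proof (rule iso_cancel_right)
  show "on_cmp F (idn C (tgt C f)) f \<bullet> (on_id F (tgt C f) \<lhd> on_arr F f)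
      = (inv2 B (on_id F (tgt C f)) \<lhd> on_arr F f) \<bullet> (on_id F (tgt C f) \<lhd> on_arr F f)"
    unfolding F_unit_left[OF f]
    using f by (simp add: F_simps C.arr_simps cell_simps)
qed (use f in \<open>simp_all add: F_simps C.arr_simps cell_simps\<close>)

text \<open>
  The value of the icon at \<open>Apex_id\<close> is forced by its unit law.  The coherence cells of \<open>G\<close> and \<open>H\<close> at
  \<open>Apex_id\<close> are inverses of whiskered unit cells, so the composition law there is an exchange of cells;
  for composites \<open>Leg \<cdot> Incl f\<close> it is the hypothesis on \<open>\<chi>\<close>.
\<close>

lemma icon_of_legs:
  assumes F: "disc_pseudofunctor C B F"
    and G: "disc_pseudofunctor (right_cone C) B G" and eqG: "pfun_eq (disc C) (cone_restrict G) F"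
    and H: "disc_pseudofunctor (right_cone C) B H" and eqH: "pfun_eq (disc C) (cone_restrict H) F"
    and apex: "on_ob G Apex = on_ob H Apex"
    and iso: "\<And>a. a \<in> obs C \<Longrightarrow> \<chi> a \<in> Iso2 B (on_arr G (Leg a)) (on_arr H (Leg a))"
    and legs: "\<And>f. f \<in> arrs C \<Longrightarrow> \<chi> (src C f) \<bullet>\<^bsub>B\<^esub> on_cmp G (Leg (tgt C f)) (Incl f)
      = on_cmp H (Leg (tgt C f)) (Incl f) \<bullet>\<^bsub>B\<^esub> (\<chi> (tgt C f) \<lhd>\<^bsub>B\<^esub> on_arr F f)"
  shows "icon (right_cone C) B G H (\<lambda>h. case h of Incl f \<Rightarrow> idn2 B (on_arr F f) | Leg a \<Rightarrow> \<chi> a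
    | Apex_id \<Rightarrow> on_id H Apex \<bullet>\<^bsub>B\<^esub> inv2 B (on_id G Apex))" (is "icon _ _ _ _ ?\<psi>")
proof -
  interpret F: disc_pseudofunctor C B F by fact
  interpret G: disc_pseudofunctor "right_cone C" B G by fact
  interpret H: disc_pseudofunctor "right_cone C" B H by fact
  note K = right_cone_sel
  have GF: "on_ob G (Base a) = on_ob F a" "on_id G (Base a) = on_id F a" if "a \<in> obs C" for a
    using that pfun_eq_disc_cone_restrict[OF eqG] by simp_all
  have GF': "on_arr G (Incl f) = on_arr F f" if "f \<in> arrs C" for f
    using that pfun_eq_disc_cone_restrict[OF eqG] by simp_all
  have HF: "on_ob H (Base a) = on_ob F a" "on_id H (Base a) = on_id F a" if "a \<in> obs C" for a
    using that pfun_eq_disc_cone_restrict[OF eqH] by simp_all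
  have HF': "on_arr H (Incl f) = on_arr F f" if "f \<in> arrs C" for f
    using that pfun_eq_disc_cone_restrict[OF eqH] by simp_all
  have same: "on_ob G x = on_ob H x" if "x \<in> obs (right_cone C)" for x
    using that apex GF HF by (auto simp: right_cone_def)
  have \<psi>: "isocell B (?\<psi> h)" "src2 B (?\<psi> h) = on_arr G h" "tgt2 B (?\<psi> h) = on_arr H h"
    if "h \<in> arrs (right_cone C)" for h
    using that iso apex
    by (auto simp: right_cone_def Iso2_iff GF' HF' K F.F_simps G.F_simps H.F_simps F.cell_simps)
  show ?thesis
  proof
    fix h k assume hk: "k \<in> arrs (right_cone C)" "h \<in> arrs (right_cone C)"
      "src (right_cone C) h = tgt (right_cone C) k"
    show "?\<psi> (h \<cdot>\<^bsub>right_cone C\<^esub> k) \<bullet>\<^bsub>B\<^esub> on_cmp G h k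
      = on_cmp H h k \<bullet>\<^bsub>B\<^esub> (?\<psi> h \<lhd>\<^bsub>B\<^esub> on_arr H k) \<bullet>\<^bsub>B\<^esub> (on_arr G h \<rhd>\<^bsub>B\<^esub> ?\<psi> k)"
    proof (cases "h = Apex_id")
      case True
      then have tk: "tgt (right_cone C) k = Apex" using hk by (simp add: K)
      have "(inv2 B (on_id G Apex) \<lhd>\<^bsub>B\<^esub> on_arr H k) \<bullet>\<^bsub>B\<^esub> (on_arr G Apex_id \<rhd>\<^bsub>B\<^esub> ?\<psi> k)
          = (idn B (on_ob G Apex) \<rhd>\<^bsub>B\<^esub> ?\<psi> k) \<bullet>\<^bsub>B\<^esub> (inv2 B (on_id G Apex) \<lhd>\<^bsub>B\<^esub> on_arr G k)"
        by (rule F.whisker_exchange)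
          (use hk(1) tk \<psi>[OF hk(1)] in \<open>simp_all add: G.F_simps K(1,2,6-9) F.cell_simps\<close>)
      with True hk(1) tk \<psi>[OF hk(1)] show ?thesis
        using G.on_cmp_idn_left[OF hk(1)] H.on_cmp_idn_left[OF hk(1)]
        by (simp add: apex G.F_simps H.F_simps K(1,2,6-9) same F.cell_simps)
    next
      case False
      with hk have "\<exists>f. k = Incl f \<and> f \<in> arrs C \<and>
          ((\<exists>g. h = Incl g \<and> g \<in> arrs C \<and> src C g = tgt C f) \<or> h = Leg (tgt C f))"
        by (auto simp: right_cone_def)
      then show ?thesis
        using legs iso pfun_eq_disc_cone_restrict(3)[OF eqG] pfun_eq_disc_cone_restrict(3)[OF eqH]
          G.F_cmp_cell[of "Incl f" for f] H.F_cmp_cell[of "Incl f" for f]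
          G.F_cmp(2,3)[of "Incl f" for f] H.F_cmp(2,3)[of "Incl f" for f]
        by (auto simp: K F.C.arr_simps GF HF GF' HF' F.F_simps Iso2_iff G.F_simps H.F_simps F.cell_simps)
    qed
  next
    fix x assume "x \<in> obs (right_cone C)"
    then show "?\<psi> (idn (right_cone C) x) \<bullet>\<^bsub>B\<^esub> on_id G x = on_id H x"
      using apex by (auto simp: right_cone_def GF HF K F.C.arr_simps F.F_simps G.F_simps H.F_simps F.cell_simps)
  qed (simp_all add: same \<psi>)
qed

text \<open>
  An icon and its inverse give transformations in both directions whose composites are identities, so
  identity modifications exhibit the equivalence.
\<close>

lemma equivalent_extensions_of_icon:
  assumes F: "disc_pseudofunctor \<Delta>2op B F"
    and icon: "icon (right_cone \<Delta>2op) B H G \<psi>"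
    and eqG: "pfun_eq (disc \<Delta>2op) (cone_restrict G) F" and eqH: "pfun_eq (disc \<Delta>2op) (cone_restrict H) F"
    and over: "\<And>f. f \<in> arrs \<Delta>2op \<Longrightarrow> \<psi> (Incl f) = idn2 B (on_arr F f)"
  shows "equivalent_extensions B F G H"
proof -
  interpret F: disc_pseudofunctor \<Delta>2op B F by fact
  interpret icon "right_cone \<Delta>2op" B H G \<psi> by fact
  interpret inv: icon "right_cone \<Delta>2op" B G H "\<lambda>f. inv2 B (\<psi> f)" by (rule icon_inverse)
  note [simp del] = One_nat_def
  let ?K = "right_cone \<Delta>2op"
  define \<sigma> where "\<sigma> = \<lparr>at_ob = (\<lambda>x. idn B (on_ob G x)), at_arr = \<psi>\<rparr>"
  define \<tau> where "\<tau> = \<lparr>at_ob = (\<lambda>x. idn B (on_ob H x)), at_arr = (\<lambda>f. inv2 B (\<psi> f))\<rparr>"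
  have \<sigma>: "pseudonatural (disc ?K) B G H \<sigma>"
    by (rule pseudonatural_icon) (simp_all add: \<sigma>_def same_ob)
  have \<tau>: "pseudonatural (disc ?K) B H G \<tau>"
    by (rule inv.pseudonatural_icon) (simp_all add: \<tau>_def same_ob)
  note simps = \<sigma>_def \<tau>_def ptrans_cmp_def ptrans_id_def disc_sel same_ob \<psi>_simps G.F_simps H.F_simps
    G.C.arr_simps F.cell_simps Hom_def Hom2_def Iso2_iff
  note trivial = icon.pseudonatural_icon[OF icon_idn2]
  have comp: "pseudonatural (disc ?K) B G G (ptrans_cmp (disc ?K) B \<tau> \<sigma>)"
    by (rule trivial[OF H.disc_pseudofunctor_axioms]) (simp_all add: simps)
  have comp': "pseudonatural (disc ?K) B H H (ptrans_cmp (disc ?K) B \<sigma> \<tau>)"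
    by (rule trivial[OF G.disc_pseudofunctor_axioms]) (simp_all add: simps)
  have idG: "pseudonatural (disc ?K) B G G (ptrans_id B G)"
    by (rule trivial[OF H.disc_pseudofunctor_axioms]) (simp_all add: ptrans_id_def)
  have idH: "pseudonatural (disc ?K) B H H (ptrans_id B H)"
    by (rule trivial[OF G.disc_pseudofunctor_axioms]) (simp_all add: ptrans_id_def)
  have modif: "modification (disc ?K) B G G (ptrans_cmp (disc ?K) B \<tau> \<sigma>) (ptrans_id B G)
        (\<lambda>x. idn2 B (idn B (on_ob G x)))"
      "modification (disc ?K) B H H (ptrans_cmp (disc ?K) B \<sigma> \<tau>) (ptrans_id B H)
        (\<lambda>x. idn2 B (idn B (on_ob H x)))"
    unfolding modification_def modification_axioms_def
    by (intro conjI allI impI comp comp' idG idH; auto simp: simps)+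
  have "invertible_modification (disc ?K) B G G (ptrans_cmp (disc ?K) B \<tau> \<sigma>) (ptrans_id B G)
        (\<lambda>x. idn2 B (idn B (on_ob G x)))"
      "invertible_modification (disc ?K) B H H (ptrans_cmp (disc ?K) B \<sigma> \<tau>) (ptrans_id B H)
        (\<lambda>x. idn2 B (idn B (on_ob H x)))"
    unfolding invertible_modification_def using modif by (auto simp: simps)
  moreover have "ptrans_over B F \<sigma>" "ptrans_over B F \<tau>"
    using pfun_eq_disc_cone_restrict(1)[OF eqG] pfun_eq_disc_cone_restrict(1)[OF eqH]
    by (auto simp: ptrans_over_def simps over F.F_simps)
  moreover have "modif_over B F (\<lambda>x. idn2 B (idn B (on_ob G x)))"
      "modif_over B F (\<lambda>x. idn2 B (idn B (on_ob H x)))"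
    using pfun_eq_disc_cone_restrict(1)[OF eqG] pfun_eq_disc_cone_restrict(1)[OF eqH]
    by (simp_all add: modif_over_def)
  ultimately show ?thesis
    unfolding equivalent_extensions_def Let_def using \<sigma> \<tau> by blast
qed

section \<open>Vertices, edges and triangles of the truncated simplex category\<close>

text \<open>
  The index of a face such as \<open>coface 1 i\<close> must not be rewritten to \<open>Suc 0\<close>, or facts about it
  would no longer match.
\<close>

declare One_nat_def [simp del]

text \<open>
  In the opposite category a vertex of \<open>[n]\<close> is an arrow \<open>n \<rightarrow> 0\<close>, an edge is an arrow \<open>n \<rightarrow> 1\<close> and a
  triangle is an arrow \<open>n \<rightarrow> 2\<close>.  Composing with a face on the left takes a face of the simplex, and
  composing with \<open>f\<close> on the right moves it along the monotone map \<open>f\<close>.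
\<close>

definition vertex :: "nat \<Rightarrow> nat \<Rightarrow> smap" where
  "vertex n i = (0, n, \<lambda>x\<in>{..0}. i)"

definition edge :: "nat \<Rightarrow> nat \<Rightarrow> nat \<Rightarrow> smap" where
  "edge n i j = (1, n, \<lambda>x\<in>{..1}. if x = 0 then i else j)"

definition triangle :: "nat \<Rightarrow> nat \<Rightarrow> nat \<Rightarrow> nat \<Rightarrow> smap" where
  "triangle n i j k = (2, n, \<lambda>x\<in>{..2}. if x = 0 then i else if x = 1 then j else k)"

definition app :: "smap \<Rightarrow> nat \<Rightarrow> nat" where
  "app f = snd (snd f)"

text \<open>
  The category is a parameter so that it stays folded in the proofs.
\<close>

locale trunc_simplex =
  fixes C :: "(nat, smap) cat"
  assumes C_eq: "C = \<Delta>2op"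
begin

lemma obs_C: "obs C = {0, 1, 2}"
  by (auto simp: C_eq opcat_def full_subcat_def Simplex_def)

lemma arrs_C: "f \<in> arrs C \<longleftrightarrow>
    (\<exists>m n g. f = (m, n, g) \<and> m \<in> {0, 1, 2} \<and> n \<in> {0, 1, 2} \<and> g \<in> {..m} \<rightarrow>\<^sub>E {..n} \<and> mono_on {..m} g)"
  by (auto simp: C_eq opcat_def full_subcat_def Simplex_def)

lemma src_C: "src C (m, n, g) = n" and tgt_C: "tgt C (m, n, g) = m"
  by (simp_all add: C_eq opcat_def full_subcat_def Simplex_def)

lemma cmp_C: "(m, n, g) \<cdot>\<^bsub>C\<^esub> (n', p, h) = (m, p, compose {..m} h g)"
  by (simp add: C_eq opcat_def full_subcat_def Simplex_def)

lemma idn_C: "idn C n = (n, n, \<lambda>x\<in>{..n}. x)"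
  by (simp add: C_eq opcat_def full_subcat_def Simplex_def)

lemma vertex_arr: "n \<in> obs C \<Longrightarrow> i \<le> n \<Longrightarrow> vertex n i \<in> arrs C"
  and edge_arr: "n \<in> obs C \<Longrightarrow> i \<le> j \<Longrightarrow> j \<le> n \<Longrightarrow> edge n i j \<in> arrs C"
  and triangle_arr: "n \<in> obs C \<Longrightarrow> i \<le> j \<Longrightarrow> j \<le> k \<Longrightarrow> k \<le> n \<Longrightarrow> triangle n i j k \<in> arrs C"
  by (auto simp: arrs_C obs_C vertex_def edge_def triangle_def monotone_on_def)

lemma ends:
  "src C (vertex n i) = n" "tgt C (vertex n i) = 0"
  "src C (edge n i j) = n" "tgt C (edge n i j) = 1"
  "src C (triangle n i j k) = n" "tgt C (triangle n i j k) = 2"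
  by (simp_all add: vertex_def edge_def triangle_def src_C tgt_C)

lemma generator_arr:
  "i \<in> {0, 1} \<Longrightarrow> coface 0 i \<in> arrs C" "i \<in> {0, 1, 2} \<Longrightarrow> coface 1 i \<in> arrs C" "codegen 0 0 \<in> arrs C"
  by (auto simp: arrs_C coface_def codegen_def monotone_on_def One_nat_def)

lemma generator_ends:
  "src C (coface 0 i) = 1" "tgt C (coface 0 i) = 0" "src C (coface 1 i) = 2" "tgt C (coface 1 i) = 1"
  "src C (codegen 0 0) = 0" "tgt C (codegen 0 0) = 1"
  by (simp_all add: coface_def codegen_def src_C tgt_C One_nat_def numeral_2_eq_2)

lemma faces:
  "coface 0 0 \<cdot>\<^bsub>C\<^esub> edge n i j = vertex n j" "coface 0 1 \<cdot>\<^bsub>C\<^esub> edge n i j = vertex n i"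
  "coface 1 0 \<cdot>\<^bsub>C\<^esub> triangle n i j k = edge n j k" "coface 1 1 \<cdot>\<^bsub>C\<^esub> triangle n i j k = edge n i k"
  "coface 1 2 \<cdot>\<^bsub>C\<^esub> triangle n i j k = edge n i j"
  by (auto simp: coface_def vertex_def edge_def triangle_def cmp_C compose_def fun_eq_iff)

lemma degenerate_edge: "codegen 0 0 \<cdot>\<^bsub>C\<^esub> vertex n i = edge n i i"
  by (auto simp: codegen_def vertex_def edge_def cmp_C compose_def fun_eq_iff One_nat_def)

lemma simplex_cmp:
  assumes "f \<in> arrs C" "tgt C f = m"
  shows "i \<le> m \<Longrightarrow> vertex m i \<cdot>\<^bsub>C\<^esub> f = vertex (src C f) (app f i)"
    "i \<le> j \<Longrightarrow> j \<le> m \<Longrightarrow> edge m i j \<cdot>\<^bsub>C\<^esub> f = edge (src C f) (app f i) (app f j)"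
proof -
  obtain n g where f: "f = (m, n, g)" using assms by (auto simp: arrs_C tgt_C)
  show "i \<le> m \<Longrightarrow> vertex m i \<cdot>\<^bsub>C\<^esub> f = vertex (src C f) (app f i)"
    "i \<le> j \<Longrightarrow> j \<le> m \<Longrightarrow> edge m i j \<cdot>\<^bsub>C\<^esub> f = edge (src C f) (app f i) (app f j)"
    by (simp_all add: f vertex_def edge_def cmp_C src_C app_def compose_def fun_eq_iff)
qed

lemma app_le: "f \<in> arrs C \<Longrightarrow> i \<le> tgt C f \<Longrightarrow> app f i \<le> src C f"
  and app_mono: "f \<in> arrs C \<Longrightarrow> i \<le> j \<Longrightarrow> j \<le> tgt C f \<Longrightarrow> app f i \<le> app f j"
  unfolding arrs_C by (elim exE conjE; simp add: app_def src_C tgt_C PiE_iff monotone_on_def)+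

lemma app_cmp: "\<lbrakk>f \<in> arrs C; g \<in> arrs C; src C g = tgt C f; i \<le> tgt C g\<rbrakk>
    \<Longrightarrow> app (g \<cdot>\<^bsub>C\<^esub> f) i = app f (app g i)"
  unfolding arrs_C by (elim exE conjE) (simp add: app_def src_C tgt_C cmp_C compose_def)

lemma app_idn: "i \<le> n \<Longrightarrow> app (idn C n) i = i"
  by (simp add: idn_C app_def)

lemma app_coface: "app (coface 0 0) 0 = 1" "app (coface 0 1) 0 = 0"
  by (simp_all add: app_def coface_def One_nat_def)

lemma idn_simplex: "idn C 0 = vertex 0 0" "idn C 1 = edge 1 0 1"
  by (auto simp: idn_C vertex_def edge_def fun_eq_iff)

lemma coface_vertex: "coface 0 0 = vertex 1 1" "coface 0 1 = vertex 1 0"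
  by (auto simp: coface_def vertex_def fun_eq_iff One_nat_def)

lemmas identities = simplicial_identities[folded C_eq]

lemmas simplex_simps = vertex_arr edge_arr triangle_arr ends generator_arr generator_ends faces
  simplex_cmp app_le app_mono

end

section \<open>The transport cells of an edge\<close>

locale cone_2cell = trunc_simplex C + disc_pseudofunctor C B F
  for C and B :: "('p, 'n, 'd) twocat" (structure) and F :: "(nat, smap, smap, 'p, 'n, 'd) pfun" +
  fixes X :: 'p and t0 :: 'n and \<theta> :: 'd
  assumes X: "X \<in> obs B"
    and t0: "t0 \<in> arrs B" "src B t0 = on_ob F 0" "tgt B t0 = X"
    and \<theta>: "isocell B \<theta>" "src2 B \<theta> = t0 \<cdot> on_arr F (coface 0 0)"
      "tgt2 B \<theta> = t0 \<cdot> on_arr F (coface 0 1)"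
begin

lemma \<theta>_cell: "\<theta> \<in> cells B"
  using \<theta>(1) by (simp add: isocell_def)

text \<open>
  Transport along an edge \<open>e\<close> from its last vertex to its first: \<open>\<theta>\<close> is whiskered with \<open>F e\<close>, and the
  coherence of \<open>F\<close> rewrites the ends \<open>t\<^sub>0 d\<^sub>0 F(e)\<close> and \<open>t\<^sub>0 d\<^sub>1 F(e)\<close> as \<open>t\<^sub>0\<close> applied to the vertices of \<open>e\<close>.
\<close>

definition \<Theta> :: "smap \<Rightarrow> 'd" where
  "\<Theta> e = (t0 \<rhd> on_cmp F (coface 0 1) e) \<bullet> (\<theta> \<lhd> on_arr F e) \<bullet> inv2 B (t0 \<rhd> on_cmp F (coface 0 0) e)"

lemmas typing = X t0 \<theta> \<theta>_cell F_simps C.arr_simps cell_simps generator_arr generator_ends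

lemma \<Theta>_iso:
  assumes "e \<in> arrs C" "tgt C e = 1"
  shows "isocell B (\<Theta> e)" "\<Theta> e \<in> cells B" "src2 B (\<Theta> e) = t0 \<cdot> on_arr F (coface 0 0 \<cdot>\<^bsub>C\<^esub> e)"
    "tgt2 B (\<Theta> e) = t0 \<cdot> on_arr F (coface 0 1 \<cdot>\<^bsub>C\<^esub> e)"
  unfolding \<Theta>_def using assms by (simp_all add: typing)

lemma \<Theta>_cmp:
  assumes "e \<in> arrs C" "tgt C e = 1"
  shows "\<Theta> e \<bullet> (t0 \<rhd> on_cmp F (coface 0 0) e) = (t0 \<rhd> on_cmp F (coface 0 1) e) \<bullet> (\<theta> \<lhd> on_arr F e)"
  unfolding \<Theta>_def using assms by (simp add: typing)

lemma t0_assoc: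
  assumes "f \<in> arrs C" "g \<in> arrs C" "h \<in> arrs C" "src C g = tgt C f" "src C h = tgt C g" "tgt C h = 0"
  shows "(t0 \<rhd> on_cmp F (h \<cdot>\<^bsub>C\<^esub> g) f) \<bullet> (t0 \<rhd> (on_cmp F h g \<lhd> on_arr F f))
    = (t0 \<rhd> on_cmp F h (g \<cdot>\<^bsub>C\<^esub> f)) \<bullet> (t0 \<rhd> (on_arr F h \<rhd> on_cmp F g f))"
  using arg_cong[OF F_assoc[OF assms(1-5)], of "\<lambda>\<gamma>. t0 \<rhd> \<gamma>"] assms by (simp add: typing)

text \<open>
  Transport along the image of an edge under \<open>f\<close> is the whiskering of the transport with \<open>F f\<close>, up to
  coherence.  The associativity law of \<open>F\<close> at both ends of the edge reduces this to the exchange of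
  \<open>\<theta>\<close> with the coherence cell of \<open>e\<close> and \<open>f\<close>.
\<close>

lemma \<Theta>_natural:
  assumes e: "e \<in> arrs C" "tgt C e = 1" and f: "f \<in> arrs C" "src C e = tgt C f"
  shows "\<Theta> (e \<cdot>\<^bsub>C\<^esub> f) \<bullet> (t0 \<rhd> on_cmp F (coface 0 0 \<cdot>\<^bsub>C\<^esub> e) f)
    = (t0 \<rhd> on_cmp F (coface 0 1 \<cdot>\<^bsub>C\<^esub> e) f) \<bullet> (\<Theta> e \<lhd> on_arr F f)"
proof (rule iso_cancel_right)
  let ?d0 = "coface 0 0" and ?d1 = "coface 0 1"
  note ty = e f \<Theta>_iso typing
  have "\<Theta> (e \<cdot>\<^bsub>C\<^esub> f) \<bullet> (t0 \<rhd> on_cmp F (?d0 \<cdot>\<^bsub>C\<^esub> e) f) \<bullet> (t0 \<rhd> (on_cmp F ?d0 e \<lhd> on_arr F f))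
      = \<Theta> (e \<cdot>\<^bsub>C\<^esub> f) \<bullet> (t0 \<rhd> on_cmp F ?d0 (e \<cdot>\<^bsub>C\<^esub> f)) \<bullet> (t0 \<rhd> (on_arr F ?d0 \<rhd> on_cmp F e f))"
    using t0_assoc[of f e ?d0] by (simp add: ty)
  also have "\<dots> = (t0 \<rhd> on_cmp F ?d1 (e \<cdot>\<^bsub>C\<^esub> f)) \<bullet> ((\<theta> \<lhd> on_arr F (e \<cdot>\<^bsub>C\<^esub> f)) \<bullet> ((t0 \<cdot> on_arr F ?d0) \<rhd> on_cmp F e f))"
    using \<Theta>_cmp[of "e \<cdot>\<^bsub>C\<^esub> f"] by (simp add: ty)
  also have "(\<theta> \<lhd> on_arr F (e \<cdot>\<^bsub>C\<^esub> f)) \<bullet> ((t0 \<cdot> on_arr F ?d0) \<rhd> on_cmp F e f)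
      = ((t0 \<cdot> on_arr F ?d1) \<rhd> on_cmp F e f) \<bullet> (\<theta> \<lhd> (on_arr F e \<cdot> on_arr F f))"
    by (rule whisker_exchange) (simp_all add: ty)
  also have "(t0 \<rhd> on_cmp F ?d1 (e \<cdot>\<^bsub>C\<^esub> f)) \<bullet> \<dots>
      = (t0 \<rhd> on_cmp F ?d1 (e \<cdot>\<^bsub>C\<^esub> f)) \<bullet> (t0 \<rhd> (on_arr F ?d1 \<rhd> on_cmp F e f)) \<bullet> (\<theta> \<lhd> on_arr F e \<lhd> on_arr F f)"
    by (simp add: ty)
  also have "\<dots> = (t0 \<rhd> on_cmp F (?d1 \<cdot>\<^bsub>C\<^esub> e) f) \<bullet> (((t0 \<rhd> on_cmp F ?d1 e) \<bullet> (\<theta> \<lhd> on_arr F e)) \<lhd> on_arr F f)"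
    using arg_cong[of _ _ "\<lambda>\<gamma>. \<gamma> \<bullet> (\<theta> \<lhd> on_arr F e \<lhd> on_arr F f)", OF t0_assoc[of f e ?d1]]
    by (simp add: ty)
  also have "\<dots> = (t0 \<rhd> on_cmp F (?d1 \<cdot>\<^bsub>C\<^esub> e) f) \<bullet> (\<Theta> e \<lhd> on_arr F f)
      \<bullet> (t0 \<rhd> (on_cmp F ?d0 e \<lhd> on_arr F f))"
    unfolding \<Theta>_cmp[OF e, symmetric] by (simp add: ty)
  finally show "\<Theta> (e \<cdot>\<^bsub>C\<^esub> f) \<bullet> (t0 \<rhd> on_cmp F (?d0 \<cdot>\<^bsub>C\<^esub> e) f) \<bullet> (t0 \<rhd> (on_cmp F ?d0 e \<lhd> on_arr F f))
      = (t0 \<rhd> on_cmp F (?d1 \<cdot>\<^bsub>C\<^esub> e) f) \<bullet> (\<Theta> e \<lhd> on_arr F f)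
      \<bullet> (t0 \<rhd> (on_cmp F ?d0 e \<lhd> on_arr F f))" .
qed (use e f in \<open>simp_all add: \<Theta>_iso typing\<close>)


lemma \<Theta>_idn: "\<Theta> (idn C 1) = \<theta>"
proof -
  let ?d0 = "coface 0 0" and ?d1 = "coface 0 1"
  have 1: "1 \<in> obs C" by (simp add: obs_C)
  note ty = 1 \<Theta>_iso typing
  have unit: "(t0 \<rhd> on_cmp F (coface 0 i) (idn C 1)) \<bullet> ((t0 \<cdot> on_arr F (coface 0 i)) \<rhd> on_id F 1)
      = idn2 B (t0 \<cdot> on_arr F (coface 0 i))" if "i \<in> {0, 1}" for i
    using arg_cong[OF F_unit_right[of "coface 0 i"], of "\<lambda>\<gamma>. t0 \<rhd> \<gamma>"] that by (simp add: ty)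
  have "\<Theta> (idn C 1) = \<Theta> (idn C 1) \<bullet> ((t0 \<rhd> on_cmp F ?d0 (idn C 1)) \<bullet> ((t0 \<cdot> on_arr F ?d0) \<rhd> on_id F 1))"
    unfolding unit[of 0, simplified] by (simp add: ty)
  also have "\<dots> = (\<Theta> (idn C 1) \<bullet> (t0 \<rhd> on_cmp F ?d0 (idn C 1))) \<bullet> ((t0 \<cdot> on_arr F ?d0) \<rhd> on_id F 1)"
    by (simp add: ty)
  also have "\<dots> = (t0 \<rhd> on_cmp F ?d1 (idn C 1)) \<bullet> ((\<theta> \<lhd> on_arr F (idn C 1)) \<bullet> ((t0 \<cdot> on_arr F ?d0) \<rhd> on_id F 1))"
    using \<Theta>_cmp[of "idn C 1"] by (simp add: ty)
  also have "(\<theta> \<lhd> on_arr F (idn C 1)) \<bullet> ((t0 \<cdot> on_arr F ?d0) \<rhd> on_id F 1)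
      = ((t0 \<cdot> on_arr F ?d1) \<rhd> on_id F 1) \<bullet> (\<theta> \<lhd> idn B (on_ob F 1))"
    by (rule whisker_exchange) (simp_all add: ty)
  also have "(t0 \<rhd> on_cmp F ?d1 (idn C 1)) \<bullet> \<dots>
      = ((t0 \<rhd> on_cmp F ?d1 (idn C 1)) \<bullet> ((t0 \<cdot> on_arr F ?d1) \<rhd> on_id F 1)) \<bullet> (\<theta> \<lhd> idn B (on_ob F 1))"
    by (rule vassoc[symmetric]) (simp_all add: ty)
  also have "\<dots> = \<theta>"
    unfolding unit[of 1, simplified] by (simp add: ty)
  finally show ?thesis .
qed

text \<open>
  The unit constraint \<open>on_id F 0\<close> cancels between \<open>\<beta>\<^sub>0\<close> and \<open>\<beta>\<^sub>1\<close>.  So the first equation of the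
  theorem says that transport along the degenerate edge of \<open>[0]\<close> is trivial.
\<close>

lemma degenerate_iff:
  "\<theta> \<lhd> degen F 0 0 = t0 \<rhd> (inv2 B (\<beta>0 B F) \<bullet> \<beta>1 B F)
    \<longleftrightarrow> \<Theta> (codegen 0 0) = idn2 B (t0 \<cdot> on_arr F (idn C 0))"
proof -
  let ?s = "codegen 0 0" and ?d0 = "coface 0 0" and ?d1 = "coface 0 1"
  have 0: "0 \<in> obs C" by (simp add: obs_C)
  note ty = 0 identities \<Theta>_iso typing
  have "inv2 B (\<beta>0 B F) \<bullet> \<beta>1 B F = inv2 B (on_cmp F ?d1 ?s) \<bullet> on_cmp F ?d0 ?s"
    by (simp add: \<beta>0_def \<beta>1_def ty)
  then have "\<theta> \<lhd> degen F 0 0 = t0 \<rhd> (inv2 B (\<beta>0 B F) \<bullet> \<beta>1 B F)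
      \<longleftrightarrow> (t0 \<rhd> on_cmp F ?d1 ?s) \<bullet> (\<theta> \<lhd> on_arr F ?s) = t0 \<rhd> on_cmp F ?d0 ?s"
    unfolding degen_def using iso_cancel_left[of "t0 \<rhd> on_cmp F ?d1 ?s" "\<theta> \<lhd> on_arr F ?s"
        "inv2 B (t0 \<rhd> on_cmp F ?d1 ?s) \<bullet> (t0 \<rhd> on_cmp F ?d0 ?s)"]
    by (auto simp: ty)
  also have "\<dots> \<longleftrightarrow> \<Theta> ?s \<bullet> (t0 \<rhd> on_cmp F ?d0 ?s) = idn2 B (t0 \<cdot> on_arr F (idn C 0)) \<bullet> (t0 \<rhd> on_cmp F ?d0 ?s)"
    by (simp add: \<Theta>_cmp ty)
  also have "\<dots> \<longleftrightarrow> \<Theta> ?s = idn2 B (t0 \<cdot> on_arr F (idn C 0))"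
    by (auto intro: iso_cancel_right[of "t0 \<rhd> on_cmp F ?d0 ?s"] simp: ty)
  finally show ?thesis .
qed

text \<open>
  The second equation of the theorem says that going along the edges \<open>12\<close> and \<open>01\<close> of \<open>[2]\<close> is the same
  as going along \<open>02\<close>: each \<open>\<alpha>\<^sub>i\<close> is one coherence cell followed by the inverse of another, and
  these combine with \<open>\<theta>\<close> whiskered by the three faces to the three transport cells.
\<close>

lemma cocycle_iff:
  "(t0 \<rhd> inv2 B (\<alpha>1 B F)) \<bullet> (\<theta> \<lhd> face F 1 0)
       = (inv2 B \<theta> \<lhd> face F 1 2) \<bullet> (t0 \<rhd> \<alpha>2 B F) \<bullet> (\<theta> \<lhd> face F 1 1) \<bullet> (t0 \<rhd> \<alpha>0 B F)
    \<longleftrightarrow> \<Theta> (coface 1 2) \<bullet> \<Theta> (coface 1 0) = \<Theta> (coface 1 1)" (is "?l = ?r \<longleftrightarrow> _")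
proof -
  note ty = identities[symmetric] \<Theta>_iso typing
  let ?k = "\<lambda>i j. t0 \<rhd> on_cmp F (coface 0 i) (coface 1 j)"
  let ?p = "?k 1 2 \<bullet> (\<theta> \<lhd> face F 1 2)" and ?q = "?k 0 0"
  have l: "?p \<bullet> ?l = \<Theta> (coface 1 2) \<bullet> \<Theta> (coface 1 0) \<bullet> ?q"
    by (simp add: \<Theta>_def \<alpha>1_def swap_def face_def ty)
  have r: "?p \<bullet> ?r = \<Theta> (coface 1 1) \<bullet> ?q"
    by (simp add: \<Theta>_def \<alpha>2_def \<alpha>0_def swap_def face_def ty)
  have "?l = ?r \<longleftrightarrow> ?p \<bullet> ?l = ?p \<bullet> ?r"
    using iso_cancel_left[of ?p ?l ?r]
    by (auto simp: \<alpha>0_def \<alpha>1_def \<alpha>2_def swap_def face_def ty simp del: vassoc)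
  also have "\<dots> \<longleftrightarrow> \<Theta> (coface 1 2) \<bullet> \<Theta> (coface 1 0) = \<Theta> (coface 1 1)"
    unfolding l r using iso_cancel_right[of ?q "\<Theta> (coface 1 2) \<bullet> \<Theta> (coface 1 0)" "\<Theta> (coface 1 1)"]
    by (auto simp: ty simp del: vassoc)
  finally show ?thesis .
qed

end

locale cone_cocycle = cone_2cell C B F X t0 \<theta>
  for C and B :: "('p, 'n, 'd) twocat" (structure) and F X t0 \<theta> +
  assumes \<Theta>_degenerate: "\<Theta> (codegen 0 0) = idn2 B (t0 \<cdot> on_arr F (idn C 0))"
    and \<Theta>_cocycle: "\<Theta> (coface 1 2) \<bullet> \<Theta> (coface 1 0) = \<Theta> (coface 1 1)"
begin

text \<open>
  Naturality carries the normalization from the degenerate edge of \<open>[0]\<close> to every degenerate edge.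
\<close>

lemma \<Theta>_edge_refl:
  assumes "n \<in> obs C" "i \<le> n"
  shows "\<Theta> (edge n i i) = idn2 B (t0 \<cdot> on_arr F (vertex n i))"
proof (rule iso_cancel_right)
  have 0: "0 \<in> obs C" by (simp add: obs_C)
  have v: "idn C 0 \<cdot>\<^bsub>C\<^esub> vertex n i = vertex n i"
    using assms by (simp add: C.arr_simps simplex_simps)
  note ty = 0 v assms identities(4,5) degenerate_edge vertex_arr ends \<Theta>_iso typing
  show "\<Theta> (edge n i i) \<bullet> (t0 \<rhd> on_cmp F (idn C 0) (vertex n i))
      = idn2 B (t0 \<cdot> on_arr F (vertex n i)) \<bullet> (t0 \<rhd> on_cmp F (idn C 0) (vertex n i))"
    using \<Theta>_natural[of "codegen 0 0" "vertex n i"] \<Theta>_degenerate by (simp add: ty)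
qed (use assms obs_C in \<open>simp_all add: simplex_simps \<Theta>_iso typing\<close>)

text \<open>
  Every triangle is the image of the 2-simplex of \<open>[2]\<close>, so naturality carries the cocycle condition
  from there to all triangles.
\<close>

lemma \<Theta>_triangle:
  assumes "n \<in> obs C" "i \<le> j" "j \<le> k" "k \<le> n"
  shows "\<Theta> (edge n i j) \<bullet> \<Theta> (edge n j k) = \<Theta> (edge n i k)"
proof (rule iso_cancel_right)
  let ?\<tau> = "triangle n i j k"
  let ?\<delta>0 = "coface 1 0" and ?\<delta>1 = "coface 1 1" and ?\<delta>2 = "coface 1 2"
  let ?k = "\<lambda>i j. t0 \<rhd> on_cmp F (coface 0 i \<cdot>\<^bsub>C\<^esub> coface 1 j) ?\<tau>"
  have "j \<le> n" "i \<le> k" using assms by simp_all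
  note ty = this assms faces edge_arr triangle_arr ends \<Theta>_iso typing
  have "\<Theta> (edge n i j) \<bullet> \<Theta> (edge n j k) \<bullet> ?k 0 0 = \<Theta> (edge n i j) \<bullet> (\<Theta> (edge n j k) \<bullet> ?k 0 0)"
    by (simp add: ty identities)
  also have "\<dots> = \<Theta> (edge n i j) \<bullet> ?k 0 2 \<bullet> (\<Theta> ?\<delta>0 \<lhd> on_arr F ?\<tau>)"
    using \<Theta>_natural[of ?\<delta>0 ?\<tau>] by (simp add: ty identities)
  also have "\<dots> = ?k 1 2 \<bullet> ((\<Theta> ?\<delta>2 \<bullet> \<Theta> ?\<delta>0) \<lhd> on_arr F ?\<tau>)"
    using \<Theta>_natural[of ?\<delta>2 ?\<tau>] by (simp add: ty identities)
  also have "\<dots> = \<Theta> (edge n i k) \<bullet> ?k 0 0"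
    unfolding \<Theta>_cocycle using \<Theta>_natural[of ?\<delta>1 ?\<tau>] by (simp add: ty identities)
  finally show "\<Theta> (edge n i j) \<bullet> \<Theta> (edge n j k) \<bullet> ?k 0 0 = \<Theta> (edge n i k) \<bullet> ?k 0 0" .
qed (use assms obs_C in \<open>simp_all add: simplex_simps \<Theta>_iso typing\<close>)

end

section \<open>The datum of a pseudococone\<close>

locale simplicial_cocone = trunc_simplex C + pseudococone C B F X t \<phi>
  for C and B :: "('p, 'n, 'd) twocat" (structure) and F X t \<phi>
begin

definition datum :: 'd where
  "datum = inv2 B (\<phi> (coface 0 1)) \<bullet> \<phi> (coface 0 0)"

lemma cone_2cell_datum: "cone_2cell C B F X (t 0) datum"
  by unfold_locales
    (simp_all add: datum_def obs_C \<phi>_simps generator_arr generator_ends F_simps C.arr_simps cell_simps)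

sublocale cone_2cell C B F X "t 0" datum
  by (rule cone_2cell_datum)

text \<open>
  For the identity edge of \<open>[1]\<close> this is the definition of the datum; whiskering with \<open>F e\<close> and the
  composition law of \<open>\<phi>\<close> give the general case.  Thus transport along an edge is a quotient of two
  values of \<open>\<phi>\<close> at vertices.
\<close>

lemma \<phi>_\<Theta>:
  assumes e: "e \<in> arrs C" "tgt C e = 1"
  shows "\<phi> (coface 0 1 \<cdot>\<^bsub>C\<^esub> e) \<bullet> \<Theta> e = \<phi> (coface 0 0 \<cdot>\<^bsub>C\<^esub> e)"
proof (rule iso_cancel_right)
  let ?d0 = "coface 0 0" and ?d1 = "coface 0 1"
  note ty = e \<phi>_simps \<Theta>_iso typing
  have "\<phi> (?d1 \<cdot>\<^bsub>C\<^esub> e) \<bullet> \<Theta> e \<bullet> (t 0 \<rhd> on_cmp F ?d0 e)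
      = \<phi> (?d1 \<cdot>\<^bsub>C\<^esub> e) \<bullet> (t 0 \<rhd> on_cmp F ?d1 e) \<bullet> (datum \<lhd> on_arr F e)"
    using \<Theta>_cmp[OF e] by (simp add: ty)
  also have "\<dots> = \<phi> e \<bullet> ((\<phi> ?d1 \<bullet> datum) \<lhd> on_arr F e)"
    using \<phi>_cmp[of e ?d1, symmetric] by (simp add: ty)
  also have "\<dots> = \<phi> (?d0 \<cdot>\<^bsub>C\<^esub> e) \<bullet> (t 0 \<rhd> on_cmp F ?d0 e)"
    using \<phi>_cmp[of e ?d0] by (simp add: datum_def ty)
  finally show "\<phi> (?d1 \<cdot>\<^bsub>C\<^esub> e) \<bullet> \<Theta> e \<bullet> (t 0 \<rhd> on_cmp F ?d0 e)
      = \<phi> (?d0 \<cdot>\<^bsub>C\<^esub> e) \<bullet> (t 0 \<rhd> on_cmp F ?d0 e)" .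
qed (use e in \<open>simp_all add: \<phi>_simps \<Theta>_iso typing\<close>)

text \<open>
  Quotients of the form \<open>\<phi>\<^sub>x\<inverse> \<phi>\<^sub>y\<close> are trivial for \<open>x = y\<close> and satisfy the cocycle condition.
\<close>

lemma cone_cocycle_datum: "cone_cocycle C B F X (t 0) datum"
proof
  have 0: "0 \<in> obs C" by (simp add: obs_C)
  note ty = 0 \<phi>_simps \<Theta>_iso typing
  show "\<Theta> (codegen 0 0) = idn2 B (t 0 \<cdot> on_arr F (idn C 0))"
    by (rule iso_cancel_left[of "\<phi> (idn C 0)"])
      (use \<phi>_\<Theta>[of "codegen 0 0"] in \<open>simp_all add: identities ty\<close>)
  show "\<Theta> (coface 1 2) \<bullet> \<Theta> (coface 1 0) = \<Theta> (coface 1 1)"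
  proof (rule iso_cancel_left)
    let ?v = "\<phi> (coface 0 1 \<cdot>\<^bsub>C\<^esub> coface 1 2)"
    have "?v \<bullet> (\<Theta> (coface 1 2) \<bullet> \<Theta> (coface 1 0)) = ?v \<bullet> \<Theta> (coface 1 2) \<bullet> \<Theta> (coface 1 0)"
      by (simp add: identities ty)
    also have "\<dots> = ?v \<bullet> \<Theta> (coface 1 1)"
      using \<phi>_\<Theta>[of "coface 1 2"] \<phi>_\<Theta>[of "coface 1 1"] \<phi>_\<Theta>[of "coface 1 0"]
      by (simp add: identities generator_arr generator_ends)
    finally show "?v \<bullet> (\<Theta> (coface 1 2) \<bullet> \<Theta> (coface 1 0)) = ?v \<bullet> \<Theta> (coface 1 1)" .
  qed (simp_all add: identities ty)
qed

end

section \<open>The pseudococone of a datum\<close>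

context cone_cocycle
begin

text \<open>
  Every leg is \<open>t\<^sub>0\<close> at the vertex \<open>0\<close>.  In degree \<open>0\<close> this would be \<open>t\<^sub>0 F(id)\<close>, which is only
  isomorphic to the prescribed 1-cell \<open>t\<^sub>0\<close>.
\<close>

definition leg :: "nat \<Rightarrow> 'n" where
  "leg n = (if n = 0 then t0 else t0 \<cdot> on_arr F (vertex n 0))"

text \<open>
  The future coherence cell at the vertex \<open>i\<close>: transport from \<open>i\<close> to the vertex \<open>0\<close>, followed in
  degree \<open>0\<close> by the correction for \<open>F(id)\<close>.
\<close>

definition to_leg :: "nat \<Rightarrow> nat \<Rightarrow> 'd" where
  "to_leg n i = (if n = 0 then inv2 B (t0 \<rhd> on_id F 0) else idn2 B (leg n)) \<bullet> \<Theta> (edge n 0 i)"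

text \<open>
  The only cell with the compatibility of \<open>leg_cell_to_leg\<close> at the vertex \<open>0\<close>.
\<close>

definition leg_cell :: "smap \<Rightarrow> 'd" where
  "leg_cell f = to_leg (src C f) (app f 0) \<bullet> (t0 \<rhd> on_cmp F (vertex (tgt C f) 0) f)
     \<bullet> inv2 B (to_leg (tgt C f) 0 \<lhd> on_arr F f)"

lemma zero_obs: "0 \<in> obs C"
  by (simp add: obs_C)

lemmas leg_typing = \<Theta>_iso typing zero_obs idn_simplex(1) ends vertex_arr edge_arr faces

lemma leg_arr:
  assumes "n \<in> obs C"
  shows "leg n \<in> arrs B" "src B (leg n) = on_ob F n" "tgt B (leg n) = X"
  using assms by (simp_all add: leg_def leg_typing)

lemma to_leg_iso:
  assumes "n \<in> obs C" "i \<le> n"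
  shows "isocell B (to_leg n i)" "to_leg n i \<in> cells B"
    "src2 B (to_leg n i) = t0 \<cdot> on_arr F (vertex n i)" "tgt2 B (to_leg n i) = leg n"
  using assms unfolding to_leg_def by (auto simp: leg_arr leg_def leg_typing)

lemma to_leg_\<Theta>:
  assumes "n \<in> obs C" "i \<le> j" "j \<le> n"
  shows "to_leg n i \<bullet> \<Theta> (edge n i j) = to_leg n j"
  using \<Theta>_triangle[of n 0 i j] assms unfolding to_leg_def
  by (auto simp: leg_arr leg_def leg_typing)

lemma leg_cell_iso:
  assumes "f \<in> arrs C"
  shows "isocell B (leg_cell f)" "leg_cell f \<in> cells B"
    "src2 B (leg_cell f) = leg (tgt C f) \<cdot> on_arr F f" "tgt2 B (leg_cell f) = leg (src C f)"
  using assms app_le[of f 0] unfolding leg_cell_def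
  by (simp_all add: to_leg_iso leg_arr leg_typing simplex_cmp)

text \<open>
  At the vertex \<open>0\<close> this holds by definition; transport along the edge from \<open>0\<close> to \<open>i\<close> and along its
  image under \<open>f\<close> gives it at every vertex.  Since \<open>to_leg\<close> is invertible, an equation between cells
  that start at a leg may be checked after composing with it at one vertex.
\<close>

lemma leg_cell_to_leg:
  assumes f: "f \<in> arrs C" and i: "i \<le> tgt C f"
  shows "leg_cell f \<bullet> (to_leg (tgt C f) i \<lhd> on_arr F f)
    = to_leg (src C f) (app f i) \<bullet> (t0 \<rhd> on_cmp F (vertex (tgt C f) i) f)"
proof -
  let ?m = "tgt C f" and ?n = "src C f"
  have m: "?m \<in> obs C" "?n \<in> obs C" using f by (simp_all add: C.arr_simps)
  note ty = f i m app_le app_mono to_leg_iso leg_arr leg_typing simplex_cmp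
  have "leg_cell f \<bullet> (to_leg ?m i \<lhd> on_arr F f)
      = leg_cell f \<bullet> ((to_leg ?m 0 \<bullet> \<Theta> (edge ?m 0 i)) \<lhd> on_arr F f)"
    using to_leg_\<Theta>[of ?m 0 i] by (simp add: ty)
  also have "\<dots> = to_leg ?n (app f 0) \<bullet>
      ((t0 \<rhd> on_cmp F (vertex ?m 0) f) \<bullet> (\<Theta> (edge ?m 0 i) \<lhd> on_arr F f))"
    by (simp add: leg_cell_def ty)
  also have "\<dots> = to_leg ?n (app f 0) \<bullet> \<Theta> (edge ?n (app f 0) (app f i)) \<bullet> (t0 \<rhd> on_cmp F (vertex ?m i) f)"
    using \<Theta>_natural[of "edge ?m 0 i" f, symmetric] by (simp add: ty)
  also have "\<dots> = to_leg ?n (app f i) \<bullet> (t0 \<rhd> on_cmp F (vertex ?m i) f)"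
    using to_leg_\<Theta>[of ?n "app f 0" "app f i"] by (simp add: ty)
  finally show ?thesis .
qed

text \<open>
  Checked at the vertex \<open>0\<close>, the composition law follows from \<open>leg_cell_to_leg\<close> at the vertices \<open>0\<close> and
  \<open>g(0)\<close>, and from the associativity of \<open>F\<close>.  The vertex \<open>g(0)\<close> need not be \<open>0\<close>, which is why
  \<open>leg_cell_to_leg\<close> is stated at all vertices.
\<close>

lemma pseudococone_leg: "pseudococone C B F X leg leg_cell"
proof
  fix f g assume fg: "f \<in> arrs C" "g \<in> arrs C" "src C g = tgt C f"
  let ?p = "tgt C g" and ?m = "tgt C f" and ?n = "src C f"
  have obs: "?p \<in> obs C" "?m \<in> obs C" "?n \<in> obs C" using fg by (simp_all add: C.arr_simps)
  have le: "app g 0 \<le> ?m" "app f (app g 0) \<le> ?n"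
    using app_le[of g 0] app_le[of f "app g 0"] fg by simp_all
  note ty = fg obs le leg_cell_iso to_leg_iso leg_arr leg_typing simplex_cmp app_cmp
  let ?x = "vertex ?p 0"
  show "leg_cell f \<bullet> (leg_cell g \<lhd> on_arr F f) = leg_cell (g \<cdot>\<^bsub>C\<^esub> f) \<bullet> (leg ?p \<rhd> on_cmp F g f)"
  proof (rule iso_cancel_right)
    have "leg_cell f \<bullet> (leg_cell g \<lhd> on_arr F f) \<bullet> (to_leg ?p 0 \<lhd> on_arr F g \<lhd> on_arr F f)
        = leg_cell f \<bullet> ((leg_cell g \<bullet> (to_leg ?p 0 \<lhd> on_arr F g)) \<lhd> on_arr F f)"
      by (simp add: ty)
    also have "\<dots> = leg_cell f \<bullet> (to_leg ?m (app g 0) \<lhd> on_arr F f) \<bullet> (t0 \<rhd> (on_cmp F ?x g \<lhd> on_arr F f))"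
      using leg_cell_to_leg[of g 0] by (simp add: ty)
    also have "\<dots> = to_leg ?n (app f (app g 0)) \<bullet>
        ((t0 \<rhd> on_cmp F (?x \<cdot>\<^bsub>C\<^esub> g) f) \<bullet> (t0 \<rhd> (on_cmp F ?x g \<lhd> on_arr F f)))"
      using leg_cell_to_leg[of f "app g 0"] by (simp add: ty)
    also have "\<dots> = to_leg ?n (app (g \<cdot>\<^bsub>C\<^esub> f) 0) \<bullet> (t0 \<rhd> on_cmp F ?x (g \<cdot>\<^bsub>C\<^esub> f))
        \<bullet> (t0 \<rhd> (on_arr F ?x \<rhd> on_cmp F g f))"
      using t0_assoc[of f g ?x] by (simp add: ty)
    also have "\<dots> = leg_cell (g \<cdot>\<^bsub>C\<^esub> f) \<bullet>
        ((to_leg ?p 0 \<lhd> on_arr F (g \<cdot>\<^bsub>C\<^esub> f)) \<bullet> ((t0 \<cdot> on_arr F ?x) \<rhd> on_cmp F g f))"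
      using arg_cong[OF leg_cell_to_leg[of "g \<cdot>\<^bsub>C\<^esub> f" 0],
          of "\<lambda>\<gamma>. \<gamma> \<bullet> (t0 \<rhd> (on_arr F ?x \<rhd> on_cmp F g f))"] by (simp add: ty)
    also have "(to_leg ?p 0 \<lhd> on_arr F (g \<cdot>\<^bsub>C\<^esub> f)) \<bullet> ((t0 \<cdot> on_arr F ?x) \<rhd> on_cmp F g f)
        = (leg ?p \<rhd> on_cmp F g f) \<bullet> (to_leg ?p 0 \<lhd> (on_arr F g \<cdot> on_arr F f))"
      by (rule whisker_exchange) (simp_all add: ty)
    finally show "leg_cell f \<bullet> (leg_cell g \<lhd> on_arr F f) \<bullet> (to_leg ?p 0 \<lhd> on_arr F g \<lhd> on_arr F f)
        = leg_cell (g \<cdot>\<^bsub>C\<^esub> f) \<bullet> (leg ?p \<rhd> on_cmp F g f) \<bullet> (to_leg ?p 0 \<lhd> on_arr F g \<lhd> on_arr F f)"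
      by (simp add: ty)
  qed (simp_all add: ty)
next
  fix n assume n: "n \<in> obs C"
  let ?x = "vertex n 0"
  note ty = n leg_cell_iso to_leg_iso leg_arr leg_typing simplex_cmp app_idn
  show "leg_cell (idn C n) \<bullet> (leg n \<rhd> on_id F n) = idn2 B (leg n)"
  proof (rule iso_cancel_right)
    have "leg_cell (idn C n) \<bullet> (leg n \<rhd> on_id F n) \<bullet> to_leg n 0
        = leg_cell (idn C n) \<bullet> ((leg n \<rhd> on_id F n) \<bullet> (to_leg n 0 \<lhd> idn B (on_ob F n)))"
      by (simp add: ty)
    also have "(leg n \<rhd> on_id F n) \<bullet> (to_leg n 0 \<lhd> idn B (on_ob F n))
        = (to_leg n 0 \<lhd> on_arr F (idn C n)) \<bullet> ((t0 \<cdot> on_arr F ?x) \<rhd> on_id F n)"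
      by (rule whisker_exchange[symmetric]) (simp_all add: ty)
    also have "leg_cell (idn C n) \<bullet> \<dots> = to_leg n 0 \<bullet> (t0 \<rhd> (on_cmp F ?x (idn C n) \<bullet> (on_arr F ?x \<rhd> on_id F n)))"
      using arg_cong[OF leg_cell_to_leg[of "idn C n" 0],
          of "\<lambda>\<gamma>. \<gamma> \<bullet> (t0 \<rhd> (on_arr F ?x \<rhd> on_id F n))"] by (simp add: ty)
    also have "\<dots> = idn2 B (leg n) \<bullet> to_leg n 0"
      using F_unit_right[of ?x] by (simp add: ty)
    finally show "leg_cell (idn C n) \<bullet> (leg n \<rhd> on_id F n) \<bullet> to_leg n 0 = idn2 B (leg n) \<bullet> to_leg n 0" .
  qed (simp_all add: ty)
qed (simp_all add: X leg_arr leg_cell_iso)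

text \<open>
  The two values of \<open>leg_cell\<close> are the cells \<open>to_leg\<close> at the two vertices of \<open>[1]\<close>, so their quotient
  is transport along the identity edge.
\<close>

lemma datum_leg: "inv2 B (leg_cell (coface 0 1)) \<bullet> leg_cell (coface 0 0) = \<theta>"
proof -
  have 1: "1 \<in> obs C" by (simp add: obs_C)
  note ty = 1 leg_cell_iso to_leg_iso leg_arr leg_typing app_coface
  have "leg_cell (coface 0 i) = to_leg 1 (app (coface 0 i) 0)" if i: "i \<in> {0, 1}" for i
  proof (rule iso_cancel_right)
    let ?c = "to_leg 0 0 \<lhd> on_arr F (coface 0 i)"
    have 0: "to_leg 0 0 = inv2 B (t0 \<rhd> on_id F 0)"
      using \<Theta>_edge_refl[of 0 0] by (simp add: to_leg_def ty)
    have "leg_cell (coface 0 i) \<bullet> ?c = to_leg 1 (app (coface 0 i) 0)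
        \<bullet> (t0 \<rhd> on_cmp F (idn C (tgt C (coface 0 i))) (coface 0 i))"
      using leg_cell_to_leg[of "coface 0 i" 0] i by (simp add: ty)
    also have "\<dots> = to_leg 1 (app (coface 0 i) 0) \<bullet> ?c"
      unfolding 0 using on_cmp_idn_left[of "coface 0 i"] i by (auto simp: ty)
    finally show "leg_cell (coface 0 i) \<bullet> ?c = to_leg 1 (app (coface 0 i) 0) \<bullet> ?c" .
  qed (use i in \<open>auto simp: leg_def coface_vertex[symmetric] ty\<close>)
  then have "inv2 B (leg_cell (coface 0 1)) \<bullet> leg_cell (coface 0 0) = \<Theta> (idn C 1)"
    using \<Theta>_edge_refl[of 1 0] by (simp add: to_leg_def leg_def idn_simplex ty)
  also have "\<dots> = \<theta>" by (rule \<Theta>_idn)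
  finally show ?thesis .
qed

end

section \<open>Comparison of pseudococones with the same datum\<close>

context simplicial_cocone
begin

lemma \<phi>_vertex_iso:
  assumes "n \<in> obs C" "i \<le> n"
  shows "isocell B (\<phi> (vertex n i))" "\<phi> (vertex n i) \<in> cells B"
    "src2 B (\<phi> (vertex n i)) = t 0 \<cdot> on_arr F (vertex n i)" "tgt2 B (\<phi> (vertex n i)) = t n"
  using assms by (simp_all add: \<phi>_simps vertex_arr ends)

lemma \<Theta>_edge:
  assumes "n \<in> obs C" "i \<le> j" "j \<le> n"
  shows "\<Theta> (edge n i j) = inv2 B (\<phi> (vertex n i)) \<bullet> \<phi> (vertex n j)"
proof -
  note ty = assms le_trans[OF assms(2,3)] \<phi>_vertex_iso edge_arr ends faces \<Theta>_iso typing
  have "\<Theta> (edge n i j) = inv2 B (\<phi> (vertex n i)) \<bullet> (\<phi> (vertex n i) \<bullet> \<Theta> (edge n i j))"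
    by (simp add: ty)
  also have "\<dots> = inv2 B (\<phi> (vertex n i)) \<bullet> \<phi> (vertex n j)"
    using \<phi>_\<Theta>[of "edge n i j"] by (simp add: ty)
  finally show ?thesis .
qed

end

text \<open>
  The cell \<open>\<phi>' \<phi>\<inverse>\<close> between the legs can be formed at any vertex.  By \<open>\<Theta>_edge\<close> the quotients of
  \<open>\<phi>\<close> at two vertices depend only on \<open>t 0\<close> and the datum, so the choice of the vertex does not
  matter, and this independence gives the compatibility with \<open>\<phi>\<close> and \<open>\<phi>'\<close>.
\<close>

lemma cocone_comparison:
  assumes P: "simplicial_cocone C B F X t \<phi>" and Q: "simplicial_cocone C B F X t' \<phi>'"
    and t: "t 0 = t' 0"
    and eq: "simplicial_cocone.datum B \<phi> = simplicial_cocone.datum B \<phi>'"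
  obtains \<chi> where "\<And>n. n \<in> obs C \<Longrightarrow> \<chi> n \<in> Iso2 B (t n) (t' n)"
    "\<And>f. f \<in> arrs C \<Longrightarrow> \<chi> (src C f) \<bullet>\<^bsub>B\<^esub> \<phi> f = \<phi>' f \<bullet>\<^bsub>B\<^esub> (\<chi> (tgt C f) \<lhd>\<^bsub>B\<^esub> on_arr F f)"
proof
  interpret P: simplicial_cocone C B F X t \<phi> by fact
  interpret Q: simplicial_cocone C B F X t' \<phi>' by fact
  define \<chi> where "\<chi> n = \<phi>' (vertex n 0) \<bullet>\<^bsub>B\<^esub> inv2 B (\<phi> (vertex n 0))" for n
  note vertex_ty = P.\<phi>_vertex_iso Q.\<phi>_vertex_iso t[symmetric]
  show iso: "\<chi> n \<in> Iso2 B (t n) (t' n)" if "n \<in> obs C" for n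
    using that by (simp add: \<chi>_def Iso2_iff vertex_ty P.cell_simps)
  have vertex: "\<chi> n \<bullet>\<^bsub>B\<^esub> \<phi> (vertex n i) = \<phi>' (vertex n i)" if n: "n \<in> obs C" "i \<le> n" for n i
  proof -
    note ty = n vertex_ty P.cell_simps
    have "inv2 B (\<phi> (vertex n 0)) \<bullet>\<^bsub>B\<^esub> \<phi> (vertex n i) = inv2 B (\<phi>' (vertex n 0)) \<bullet>\<^bsub>B\<^esub> \<phi>' (vertex n i)"
      using P.\<Theta>_edge[of n 0 i] Q.\<Theta>_edge[of n 0 i] n unfolding t eq by simp
    then show ?thesis by (simp add: \<chi>_def ty)
  qed
  fix f assume f: "f \<in> arrs C"
  let ?m = "tgt C f" and ?n = "src C f" and ?x = "vertex (tgt C f) 0"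
  have obs: "?m \<in> obs C" "?n \<in> obs C" using f by (simp_all add: P.C.arr_simps)
  have \<chi>: "isocell B (\<chi> n)" "\<chi> n \<in> cells B" "src2 B (\<chi> n) = t n" "tgt2 B (\<chi> n) = t' n"
    if "n \<in> obs C" for n using iso[OF that] by (simp_all add: Iso2_iff isocell_def)
  have le: "app f 0 \<le> ?n" using P.app_le[OF f] by simp
  note ty = f obs le \<chi> vertex_ty P.\<phi>_simps Q.\<phi>_simps P.vertex_arr P.ends P.simplex_cmp P.typing
  show "\<chi> ?n \<bullet>\<^bsub>B\<^esub> \<phi> f = \<phi>' f \<bullet>\<^bsub>B\<^esub> (\<chi> ?m \<lhd>\<^bsub>B\<^esub> on_arr F f)"
  proof (rule P.iso_cancel_right)
    have "\<chi> ?n \<bullet>\<^bsub>B\<^esub> \<phi> f \<bullet>\<^bsub>B\<^esub> (\<phi> ?x \<lhd>\<^bsub>B\<^esub> on_arr F f)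
        = \<chi> ?n \<bullet>\<^bsub>B\<^esub> \<phi> (vertex ?n (app f 0)) \<bullet>\<^bsub>B\<^esub> (t 0 \<rhd>\<^bsub>B\<^esub> on_cmp F ?x f)"
      using P.\<phi>_cmp[of f ?x] by (simp add: ty)
    also have "\<dots> = \<phi>' f \<bullet>\<^bsub>B\<^esub> (\<phi>' ?x \<lhd>\<^bsub>B\<^esub> on_arr F f)"
      unfolding vertex[OF obs(2) le] using Q.\<phi>_cmp[of f ?x] by (simp add: ty)
    also have "\<dots> = \<phi>' f \<bullet>\<^bsub>B\<^esub> (\<chi> ?m \<lhd>\<^bsub>B\<^esub> on_arr F f) \<bullet>\<^bsub>B\<^esub> (\<phi> ?x \<lhd>\<^bsub>B\<^esub> on_arr F f)"
      unfolding vertex[OF obs(1), of 0, simplified, symmetric] by (simp add: ty)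
    finally show "\<chi> ?n \<bullet>\<^bsub>B\<^esub> \<phi> f \<bullet>\<^bsub>B\<^esub> (\<phi> ?x \<lhd>\<^bsub>B\<^esub> on_arr F f)
      = \<phi>' f \<bullet>\<^bsub>B\<^esub> (\<chi> ?m \<lhd>\<^bsub>B\<^esub> on_arr F f) \<bullet>\<^bsub>B\<^esub> (\<phi> ?x \<lhd>\<^bsub>B\<^esub> on_arr F f)" .
  qed (simp_all add: ty)
qed

section \<open>Classification of the extensions\<close>

lemma (in cone_2cell) cone_datum_iff:
  "cone_datum B F X t0 \<theta> \<longleftrightarrow> cone_cocycle C B F X t0 \<theta>"
  using X t0 \<theta> cone_2cell_axioms unfolding cone_datum_def degenerate_iff cocycle_iff
  by (auto simp: cone_cocycle_def cone_cocycle_axioms_def Hom_def Iso2_iff face_def)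

lemma cone_2cell_of_cone_datum:
  assumes "disc_pseudofunctor \<Delta>2op B F" "cone_datum B F X t0 \<theta>"
  shows "cone_2cell \<Delta>2op B F X t0 \<theta>"
  using assms
  by (simp add: cone_2cell_def cone_2cell_axioms_def trunc_simplex_def cone_datum_def Hom_def Iso2_iff face_def)

lemma simplicial_cocone_of_extension:
  assumes F: "disc_pseudofunctor \<Delta>2op B F" and G: "extension B F G"
  defines "\<phi> \<equiv> \<lambda>f. on_cmp G (Leg (tgt \<Delta>2op f)) (Incl f)"
  shows "simplicial_cocone \<Delta>2op B F (ext_apex G) (\<lambda>n. on_arr G (Leg n)) \<phi>"
    and "simplicial_cocone.datum B \<phi> = ext_theta B G"
proof -
  have C: "category \<Delta>2op" and K: "category (right_cone \<Delta>2op)"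
    by (intro category_right_cone category_opcat category_full_subcat category_Simplex)+
  have "disc_pseudofunctor (right_cone \<Delta>2op) B G" "pfun_eq (disc \<Delta>2op) (cone_restrict G) F"
    using G by (simp_all add: extension_def pseudofunctor_disc_iff[OF K])
  from pseudococone_of_extension[OF F this]
  show cocone: "simplicial_cocone \<Delta>2op B F (ext_apex G) (\<lambda>n. on_arr G (Leg n)) \<phi>"
    by (simp add: simplicial_cocone_def trunc_simplex_def ext_apex_def \<phi>_def)
  interpret simplicial_cocone \<Delta>2op B F "ext_apex G" "\<lambda>n. on_arr G (Leg n)" \<phi> by (rule cocone)
  show "datum = ext_theta B G"
    unfolding datum_def ext_theta_def swap_def by (simp add: \<phi>_def generator_ends)
qed

theorem theoremA18:
  fixes B :: "('p, 'n, 'd) twocat"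
    and F :: "(nat, smap, smap, 'p, 'n, 'd) pfun"
  assumes "two_category B"
    and "pseudofunctor (disc \<Delta>2op) B F"
  shows "(\<forall>G. extension B F G \<longrightarrow>
            cone_datum B F (ext_apex G) (ext_leg G) (ext_theta B G)) \<and>
         (\<forall>Bf t0 \<theta>. cone_datum B F Bf t0 \<theta> \<longrightarrow>
            (\<exists>G. extension B F G \<and> ext_apex G = Bf \<and> ext_leg G = t0 \<and> ext_theta B G = \<theta>)) \<and>
         (\<forall>G H. extension B F G \<and> extension B F H \<and> ext_apex G = ext_apex H \<and>
            ext_leg G = ext_leg H \<and> ext_theta B G = ext_theta B H \<longrightarrow>
            equivalent_extensions B F G H)"
proof (intro conjI allI impI; (elim conjE)?)
  have C: "category \<Delta>2op" and K: "category (right_cone \<Delta>2op)"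
    by (intro category_right_cone category_opcat category_full_subcat category_Simplex)+
  have F: "disc_pseudofunctor \<Delta>2op B F"
    using assms(2) pseudofunctor_disc_iff[OF C] by blast
  note cocone = simplicial_cocone_of_extension[OF F]
  {
    fix G assume G: "extension B F G"
    interpret simplicial_cocone \<Delta>2op B F "ext_apex G" "\<lambda>n. on_arr G (Leg n)"
      "\<lambda>f. on_cmp G (Leg (tgt \<Delta>2op f)) (Incl f)" by (rule cocone(1)[OF G])
    show "cone_datum B F (ext_apex G) (ext_leg G) (ext_theta B G)"
      using cone_datum_iff cone_cocycle_datum unfolding cocone(2)[OF G] ext_leg_def by blast
  next
    fix X t0 \<theta> assume D: "cone_datum B F X t0 \<theta>"
    interpret cone_2cell \<Delta>2op B F X t0 \<theta> by (rule cone_2cell_of_cone_datum[OF F D])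
    interpret cone_cocycle \<Delta>2op B F X t0 \<theta> using D cone_datum_iff by blast
    interpret L: pseudococone \<Delta>2op B F X leg leg_cell by (rule pseudococone_leg)
    have G: "extension B F L.cone_ext"
      using L.disc_pseudofunctor_cone_ext L.cone_ext_restrict
      by (simp add: extension_def pseudofunctor_disc_iff[OF K])
    moreover have "ext_apex L.cone_ext = X" "ext_leg L.cone_ext = t0" "ext_theta B L.cone_ext = \<theta>"
      using datum_leg
      by (simp_all add: L.cone_ext_def Let_def ext_apex_def ext_leg_def ext_theta_def swap_def leg_def)
    ultimately show "\<exists>G. extension B F G \<and> ext_apex G = X \<and> ext_leg G = t0 \<and> ext_theta B G = \<theta>"
      by blast
  next
    fix G H assume G: "extension B F G" and H: "extension B F H"
      and eq: "ext_apex G = ext_apex H" "ext_leg G = ext_leg H" "ext_theta B G = ext_theta B H"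
    have GH: "disc_pseudofunctor (right_cone \<Delta>2op) B G" "pfun_eq (disc \<Delta>2op) (cone_restrict G) F"
      "disc_pseudofunctor (right_cone \<Delta>2op) B H" "pfun_eq (disc \<Delta>2op) (cone_restrict H) F"
      using G H by (simp_all add: extension_def pseudofunctor_disc_iff[OF K])
    have legs: "on_arr H (Leg 0) = on_arr G (Leg 0)"
      using eq(2) by (simp add: ext_leg_def)
    obtain \<chi> where \<chi>: "\<And>n. n \<in> obs \<Delta>2op \<Longrightarrow> \<chi> n \<in> Iso2 B (on_arr H (Leg n)) (on_arr G (Leg n))"
      "\<And>f. f \<in> arrs \<Delta>2op \<Longrightarrow> \<chi> (src \<Delta>2op f) \<bullet>\<^bsub>B\<^esub> on_cmp H (Leg (tgt \<Delta>2op f)) (Incl f)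
        = on_cmp G (Leg (tgt \<Delta>2op f)) (Incl f) \<bullet>\<^bsub>B\<^esub> (\<chi> (tgt \<Delta>2op f) \<lhd>\<^bsub>B\<^esub> on_arr F f)"
      using cocone_comparison[OF cocone(1)[OF H] cocone(1)[OF G, unfolded eq(1)] legs
          trans[OF cocone(2)[OF H] trans[OF eq(3)[symmetric] cocone(2)[OF G, symmetric]]]]
      by blast
    have "icon (right_cone \<Delta>2op) B H G (\<lambda>h. case h of Incl f \<Rightarrow> idn2 B (on_arr F f) | Leg a \<Rightarrow> \<chi> a
        | Apex_id \<Rightarrow> on_id G Apex \<bullet>\<^bsub>B\<^esub> inv2 B (on_id H Apex))"
      using eq(1) by (intro icon_of_legs[OF F GH(3,4,1,2)] \<chi>) (simp_all add: ext_apex_def)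
    then show "equivalent_extensions B F G H"
      by (rule equivalent_extensions_of_icon[OF F _ GH(2,4)]) simp
  }
qed

end
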